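(* Let $(X,\mathcal{B},\mu)$ be the standard (non-atomic) probability measure space. Every finite partition of $X$ into positive measure sets, regarded as a tuple in the metric structure $\mathrm{MALG}$, is ample.
   Context: $\mathrm{MALG}$ is the measure algebra of sets in $\mathcal{B}$ modulo null sets (elements are referred to as sets), with metric $\rho(A,B)=\mu(A\triangle B)$, regarded as a metric structure with this metric, the operation of symmetric difference $\triangle$, and the constant $\emptyset$. $G=\mathrm{Aut}(\mathrm{MALG})$ is the group of bijections of $\mathrm{MALG}$ preserving $\rho$, $\triangle$ and $\emptyset$. Tuples are finite. For a tuple $\bar b$, $G_{\bar b}$ is the pointwise stabilizer of $\bar b$ in $G$, and for $W\subseteq G$, $W[\bar a]=\{w(\bar a):w\in W\}$. Formulas are classical first-order formulas in which real numbers may be used as constants of the second sort (e.g. $\rho(x,y)=r$ is a quantifier-free formula). $\mathrm{qftp}(\bar a)$ and $\mathrm{qftp}(\bar a/\bar b)$ denote the quantifier-free type of $\bar a$, respectively of $\bar a$ over $\bar b$; $p(\mathrm{MALG})$ is the set of realizations of $p$ in $\mathrm{MALG}$ (a subspace of $\mathrm{MALG}^n$). For an $n$-tuple $\bar a$, an $n$-tuple of variables $\bar x$ and $\epsilon>0$, a quantifier-free type $p(\bar x/\bar a)$ over $\bar a$ is an $\epsilon$-quantifier-free type over $\bar a$ if it contains $\mathrm{qftp}(\bar a)$ (in the variables $\bar x$) and for each $i\le n$ it contains $\rho(a^i,x^i)=d_i$ for some $0\le d_i<\epsilon$. For $p=\mathrm{qftp}(\bar a)$, a subset $Y\subseteq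 p(\mathrm{MALG})$ is relatively $\epsilon$-saturated over $\bar a$ if every $\epsilon$-quantifier-free type over $\bar a$ realized in $\mathrm{MALG}$ is also realized in $Y$. A tuple $\bar a$ with $p=\mathrm{qftp}(\bar a)$ is ample if the set of all tuples $\bar b\in p(\mathrm{MALG})$ such that $G_{\bar b}[\bar a]$ is relatively $\delta$-saturated over $\bar a$ for some $\delta>0$ is comeager in $p(\mathrm{MALG})$. *)

theory Defs
  imports "HOL-Probability.Probability"
begin

section \<open>Standard non-atomic probability spaces\<close>

definition standard_borel :: "'a measure \<Rightarrow> bool" where
  "standard_borel M \<longleftrightarrow>
     (\<exists>T. topspace T = space M \<and> completely_metrizable_space T \<and> second_countable T \<and>
          sets M = sigma_sets (space M) {U. openin T U})"

definition atomless :: "'a measure \<Rightarrow> bool" where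
  "atomless M \<longleftrightarrow>
     (\<forall>A\<in>sets M. 0 < measure M A \<longrightarrow>
        (\<exists>B\<in>sets M. B \<subseteq> A \<and> 0 < measure M B \<and> measure M B < measure M A))"

definition standard_probability_space :: "'a measure \<Rightarrow> bool" where
  "standard_probability_space M \<longleftrightarrow> prob_space M \<and> standard_borel M \<and> atomless M"


section \<open>The measure algebra as a metric structure\<close>

definition malg_rel :: "'a measure \<Rightarrow> ('a set \<times> 'a set) set" where
  "malg_rel M = {(A, B). A \<in> sets M \<and> B \<in> sets M \<and> measure M (sym_diff A B) = 0}"

definition malg :: "'a measure \<Rightarrow> 'a set set set" where
  "malg M = sets M // malg_rel M"

definition malg_class :: "'a measure \<Rightarrow> 'a set \<Rightarrow> 'a set set" where
  "malg_class M A = malg_rel M `` {A}"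

definition malg_rep :: "'a set set \<Rightarrow> 'a set" where
  "malg_rep a = (SOME A. A \<in> a)"

definition malg_dist :: "'a measure \<Rightarrow> 'a set set \<Rightarrow> 'a set set \<Rightarrow> real" where
  "malg_dist M a b = measure M (sym_diff (malg_rep a) (malg_rep b))"

definition malg_sdiff :: "'a measure \<Rightarrow> 'a set set \<Rightarrow> 'a set set \<Rightarrow> 'a set set" where
  "malg_sdiff M a b = malg_class M (sym_diff (malg_rep a) (malg_rep b))"

definition malg_empty :: "'a measure \<Rightarrow> 'a set set" where
  "malg_empty M = malg_class M {}"

text \<open>
  The operations are independent of the chosen representatives, and \<open>malg_dist\<close> is a metric on
  \<open>malg\<close>, so that \<open>Metric_space.mtopology\<close> below is the metric topology.
\<close>

context prob_space
begin

lemma sym_diff_triangle: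
  assumes "A \<in> sets M" "B \<in> sets M" "C \<in> sets M"
  shows "measure M (sym_diff A C) \<le> measure M (sym_diff A B) + measure M (sym_diff B C)"
proof -
  have "measure M (sym_diff A C) \<le> measure M (sym_diff A B \<union> sym_diff B C)"
    using assms by (intro finite_measure_mono) auto
  also have "\<dots> \<le> measure M (sym_diff A B) + measure M (sym_diff B C)"
    using assms by (intro measure_Un_le) auto
  finally show ?thesis .
qed

lemma equiv_malg_rel: "equiv (sets M) (malg_rel M)"
proof (rule equivI)
  show "malg_rel M \<subseteq> sets M \<times> sets M"
    by (auto simp: malg_rel_def)
  show "refl_on (sets M) (malg_rel M)"
    by (auto simp: refl_on_def malg_rel_def)
  show "sym (malg_rel M)"
    by (auto simp: sym_def malg_rel_def Un_commute)
  show "trans (malg_rel M)"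
  proof (rule transI)
    fix A B C assume "(A, B) \<in> malg_rel M" "(B, C) \<in> malg_rel M"
    then show "(A, C) \<in> malg_rel M"
      using sym_diff_triangle[of A B C] measure_nonneg[of M "sym_diff A C"]
      by (simp add: malg_rel_def)
  qed
qed

lemma malg_class_in_malg: "A \<in> sets M \<Longrightarrow> malg_class M A \<in> malg M"
  by (simp add: malg_def malg_class_def quotientI)

lemma malg_class_eq_iff:
  assumes "A \<in> sets M" "B \<in> sets M"
  shows "malg_class M A = malg_class M B \<longleftrightarrow> measure M (sym_diff A B) = 0"
  using eq_equiv_class_iff[OF equiv_malg_rel assms] assms
  by (simp add: malg_class_def malg_rel_def)

lemma malg_rep:
  assumes "a \<in> malg M"
  shows "malg_rep a \<in> sets M" "malg_class M (malg_rep a) = a"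
proof -
  obtain A where A: "A \<in> sets M" "a = malg_rel M `` {A}"
    using assms by (auto simp: malg_def elim: quotientE)
  then have "A \<in> a"
    using equiv_class_self[OF equiv_malg_rel] by auto
  then have "malg_rep a \<in> a"
    unfolding malg_rep_def by (rule someI)
  then have r: "(A, malg_rep a) \<in> malg_rel M"
    using A by auto
  then show "malg_rep a \<in> sets M"
    by (auto simp: malg_rel_def)
  show "malg_class M (malg_rep a) = a"
    using equiv_class_eq[OF equiv_malg_rel r] A by (simp add: malg_class_def)
qed

lemma measure_sym_diff_malg_rep:
  assumes "A \<in> sets M"
  shows "measure M (sym_diff A (malg_rep (malg_class M A))) = 0"
  using assms malg_rep[OF malg_class_in_malg[OF assms]] malg_class_eq_iff by metis

lemma malg_dist_class:
  assumes A: "A \<in> sets M" and B: "B \<in> sets M"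
  shows "malg_dist M (malg_class M A) (malg_class M B) = measure M (sym_diff A B)"
proof -
  let ?A = "malg_rep (malg_class M A)" and ?B = "malg_rep (malg_class M B)"
  have s: "?A \<in> sets M" "?B \<in> sets M"
    using A B malg_rep malg_class_in_malg by auto
  have 0: "measure M (sym_diff A ?A) = 0" "measure M (sym_diff ?A A) = 0"
          "measure M (sym_diff B ?B) = 0" "measure M (sym_diff ?B B) = 0"
    using measure_sym_diff_malg_rep A B by (auto simp: Un_commute)
  show ?thesis
    unfolding malg_dist_def
    using sym_diff_triangle[of ?A A ?B] sym_diff_triangle[of A B ?B]
      sym_diff_triangle[of A ?A B] sym_diff_triangle[of ?A ?B B] A B s 0
    by linarith
qed

lemma malg_sdiff_class:
  assumes A: "A \<in> sets M" and B: "B \<in> sets M"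
  shows "malg_sdiff M (malg_class M A) (malg_class M B) = malg_class M (sym_diff A B)"
proof -
  let ?A = "malg_rep (malg_class M A)" and ?B = "malg_rep (malg_class M B)"
  have s: "?A \<in> sets M" "?B \<in> sets M"
    using A B malg_rep malg_class_in_malg by auto
  have "measure M (sym_diff (sym_diff ?A ?B) (sym_diff A B))
        \<le> measure M (sym_diff A ?A \<union> sym_diff B ?B)"
    using A B s by (intro finite_measure_mono) auto
  also have "\<dots> \<le> measure M (sym_diff A ?A) + measure M (sym_diff B ?B)"
    using A B s by (intro measure_Un_le) auto
  also have "\<dots> = 0"
    using measure_sym_diff_malg_rep A B by simp
  finally have "measure M (sym_diff (sym_diff ?A ?B) (sym_diff A B)) = 0"
    by (simp add: measure_le_0_iff)
  then show ?thesis
    unfolding malg_sdiff_def using A B s by (subst malg_class_eq_iff) auto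
qed

lemma Metric_space_malg: "Metric_space (malg M) (malg_dist M)"
proof
  fix a b c
  show "0 \<le> malg_dist M a b"
    by (simp add: malg_dist_def)
  show "malg_dist M a b = malg_dist M b a"
    by (simp add: malg_dist_def Un_commute)
  assume a: "a \<in> malg M" and b: "b \<in> malg M"
  show "malg_dist M a b = 0 \<longleftrightarrow> a = b"
    using malg_class_eq_iff malg_rep[OF a] malg_rep[OF b] unfolding malg_dist_def by metis
  assume c: "c \<in> malg M"
  show "malg_dist M a c \<le> malg_dist M a b + malg_dist M b c"
    using sym_diff_triangle malg_rep a b c unfolding malg_dist_def by blast
qed

end

definition malg_Aut :: "'a measure \<Rightarrow> ('a set set \<Rightarrow> 'a set set) set" where
  "malg_Aut M =
     {g \<in> extensional (malg M). bij_betw g (malg M) (malg M) \<and>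
        (\<forall>a\<in>malg M. \<forall>b\<in>malg M. malg_dist M (g a) (g b) = malg_dist M a b) \<and>
        (\<forall>a\<in>malg M. \<forall>b\<in>malg M. g (malg_sdiff M a b) = malg_sdiff M (g a) (g b)) \<and>
        g (malg_empty M) = malg_empty M}"


section \<open>Tuples\<close>

text \<open>An \<open>n\<close>-tuple is an extensional function on \<open>{..<n}\<close>.\<close>

definition malg_tuples :: "'a measure \<Rightarrow> nat \<Rightarrow> (nat \<Rightarrow> 'a set set) set" where
  "malg_tuples M n = ({..<n} \<rightarrow>\<^sub>E malg M)"

definition malg_power_topology :: "'a measure \<Rightarrow> nat \<Rightarrow> (nat \<Rightarrow> 'a set set) topology" where
  "malg_power_topology M n =
     product_topology (\<lambda>_. Metric_space.mtopology (malg M) (malg_dist M)) {..<n}"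

definition stabilizer :: "'a measure \<Rightarrow> nat \<Rightarrow> (nat \<Rightarrow> 'a set set) \<Rightarrow> ('a set set \<Rightarrow> 'a set set) set"
  where "stabilizer M n b = {g \<in> malg_Aut M. \<forall>i<n. g (b i) = b i}"

definition tuple_orbit ::
  "('a set set \<Rightarrow> 'a set set) set \<Rightarrow> nat \<Rightarrow> (nat \<Rightarrow> 'a set set) \<Rightarrow> (nat \<Rightarrow> 'a set set) set"
  where "tuple_orbit W n a = {\<lambda>i\<in>{..<n}. w (a i) | w. w \<in> W}"


section \<open>Quantifier-free formulas and types\<close>

text \<open>
  Two-sorted formulas in variables \<open>Var i\<close> of the first sort and parameters \<open>Par c\<close>. All reals are
  constants of the second sort; hence other relations or operations on the reals, such as the
  order, would not change which tuples realize the same quantifier-free type.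
\<close>

datatype 'c malg_term =
    Var nat
  | Par 'c
  | Empt
  | SDiff "'c malg_term" "'c malg_term"

datatype 'c real_term =
    RConst real
  | Rho "'c malg_term" "'c malg_term"

datatype 'c qf_formula =
    EqM "'c malg_term" "'c malg_term"
  | EqR "'c real_term" "'c real_term"
  | Neg "'c qf_formula"
  | Conj "'c qf_formula" "'c qf_formula"

primrec term_vars :: "'c malg_term \<Rightarrow> nat set" where
  "term_vars (Var i) = {i}"
| "term_vars (Par c) = {}"
| "term_vars Empt = {}"
| "term_vars (SDiff s t) = term_vars s \<union> term_vars t"

primrec real_term_vars :: "'c real_term \<Rightarrow> nat set" where
  "real_term_vars (RConst r) = {}"
| "real_term_vars (Rho s t) = term_vars s \<union> term_vars t"

primrec qf_vars :: "'c qf_formula \<Rightarrow> nat set" where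
  "qf_vars (EqM s t) = term_vars s \<union> term_vars t"
| "qf_vars (EqR s t) = real_term_vars s \<union> real_term_vars t"
| "qf_vars (Neg \<phi>) = qf_vars \<phi>"
| "qf_vars (Conj \<phi> \<psi>) = qf_vars \<phi> \<union> qf_vars \<psi>"

primrec malg_term_val ::
  "'a measure \<Rightarrow> (nat \<Rightarrow> 'a set set) \<Rightarrow> 'a set set malg_term \<Rightarrow> 'a set set" where
  "malg_term_val M x (Var i) = x i"
| "malg_term_val M x (Par c) = c"
| "malg_term_val M x Empt = malg_empty M"
| "malg_term_val M x (SDiff s t) = malg_sdiff M (malg_term_val M x s) (malg_term_val M x t)"

primrec real_term_val ::
  "'a measure \<Rightarrow> (nat \<Rightarrow> 'a set set) \<Rightarrow> 'a set set real_term \<Rightarrow> real" where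
  "real_term_val M x (RConst r) = r"
| "real_term_val M x (Rho s t) = malg_dist M (malg_term_val M x s) (malg_term_val M x t)"

primrec qf_sat ::
  "'a measure \<Rightarrow> (nat \<Rightarrow> 'a set set) \<Rightarrow> 'a set set qf_formula \<Rightarrow> bool" where
  "qf_sat M x (EqM s t) \<longleftrightarrow> malg_term_val M x s = malg_term_val M x t"
| "qf_sat M x (EqR s t) \<longleftrightarrow> real_term_val M x s = real_term_val M x t"
| "qf_sat M x (Neg \<phi>) \<longleftrightarrow> \<not> qf_sat M x \<phi>"
| "qf_sat M x (Conj \<phi> \<psi>) \<longleftrightarrow> qf_sat M x \<phi> \<and> qf_sat M x \<psi>"

text \<open>The formulas in \<open>n\<close> variables over \<open>B\<close>; \<open>set_qf_formula\<close> collects the parameters.\<close>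

definition qf_formulas :: "nat \<Rightarrow> 'c set \<Rightarrow> 'c qf_formula set" where
  "qf_formulas n B = {\<phi>. qf_vars \<phi> \<subseteq> {..<n} \<and> set_qf_formula \<phi> \<subseteq> B}"

definition realizations ::
  "'a measure \<Rightarrow> nat \<Rightarrow> 'a set set qf_formula set \<Rightarrow> (nat \<Rightarrow> 'a set set) set" where
  "realizations M n p = {c \<in> malg_tuples M n. \<forall>\<phi>\<in>p. qf_sat M c \<phi>}"

definition qftp ::
  "'a measure \<Rightarrow> nat \<Rightarrow> (nat \<Rightarrow> 'a set set) \<Rightarrow> 'a set set qf_formula set" where
  "qftp M n a = {\<phi> \<in> qf_formulas n {}. qf_sat M a \<phi>}"

text \<open>Types need not be complete.\<close>

definition qf_type ::
  "'a measure \<Rightarrow> nat \<Rightarrow> 'a set set set \<Rightarrow> 'a set set qf_formula set \<Rightarrow> bool" where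
  "qf_type M n B p \<longleftrightarrow>
     p \<subseteq> qf_formulas n B \<and> (\<forall>F\<subseteq>p. finite F \<longrightarrow> realizations M n F \<noteq> {})"

definition eps_qf_type ::
  "'a measure \<Rightarrow> nat \<Rightarrow> real \<Rightarrow> (nat \<Rightarrow> 'a set set) \<Rightarrow> 'a set set qf_formula set \<Rightarrow> bool" where
  "eps_qf_type M n \<epsilon> a p \<longleftrightarrow>
     qf_type M n (a ` {..<n}) p \<and> qftp M n a \<subseteq> p \<and>
     (\<forall>i<n. \<exists>d. 0 \<le> d \<and> d < \<epsilon> \<and> EqR (Rho (Par (a i)) (Var i)) (RConst d) \<in> p)"


section \<open>Ampleness\<close>

definition relatively_saturated ::
  "'a measure \<Rightarrow> nat \<Rightarrow> real \<Rightarrow> (nat \<Rightarrow> 'a set set) \<Rightarrow> (nat \<Rightarrow> 'a set set) set \<Rightarrow> bool" where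
  "relatively_saturated M n \<epsilon> a Y \<longleftrightarrow>
     Y \<subseteq> realizations M n (qftp M n a) \<and>
     (\<forall>p. eps_qf_type M n \<epsilon> a p \<and> realizations M n p \<noteq> {} \<longrightarrow> realizations M n p \<inter> Y \<noteq> {})"

definition nowhere_dense_in :: "'b topology \<Rightarrow> 'b set \<Rightarrow> bool" where
  "nowhere_dense_in T S \<longleftrightarrow> S \<subseteq> topspace T \<and> T interior_of (T closure_of S) = {}"

definition comeager_in :: "'b topology \<Rightarrow> 'b set \<Rightarrow> bool" where
  "comeager_in T S \<longleftrightarrow> S \<subseteq> topspace T \<and>
     (\<exists>N :: nat \<Rightarrow> 'b set. (\<forall>k. nowhere_dense_in T (N k)) \<and> topspace T - S \<subseteq> (\<Union>k. N k))"

definition ample :: "'a measure \<Rightarrow> nat \<Rightarrow> (nat \<Rightarrow> 'a set set) \<Rightarrow> bool" where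
  "ample M n a \<longleftrightarrow>
     comeager_in (subtopology (malg_power_topology M n) (realizations M n (qftp M n a)))
       {b \<in> realizations M n (qftp M n a).
          \<exists>\<delta>>0. relatively_saturated M n \<delta> a (tuple_orbit (stabilizer M n b) n a)}"

end

theory Submission
  imports Defs
begin

text \<open>
  Fix a partition \<open>A\<close> of the space into \<open>n\<close> sets of positive measure and let \<open>a\<close> be the tuple of
  their classes. The proof rests on homogeneity: in the measure algebra of a standard atomless
  space, two finite disjoint families with the same measures are related by an automorphism
  (\<open>automorphism_of_disjoint_families\<close>). Consequently a quantifier-free type of partitions is a table
  of measures. The realizations of \<open>qftp a\<close> are exactly the partitions whose pieces have the same
  measures as those of \<open>A\<close> (\<open>partition_realizes_qftp\<close>, \<open>qftp_realization_is_partition\<close>), and the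
  type over \<open>a\<close> of such a partition \<open>C\<close> is determined by the numbers \<open>prob (C i \<inter> A j)\<close>.

  The generic partitions \<open>B\<close> are those in which every piece meets every piece of \<open>A\<close> in positive
  measure. For such a \<open>B\<close> let \<open>\<delta>\<close> be the least of the numbers \<open>prob (A i \<inter> B k)\<close>. If \<open>C\<close> realizes a
  \<open>\<delta>\<close>-type over \<open>a\<close>, one seeks a partition \<open>D\<close> that lies over \<open>B\<close> as \<open>A\<close> does and over \<open>A\<close> as \<open>C\<close>
  does. By homogeneity \<open>D\<close> is then in the orbit of \<open>a\<close> under the stabilizer of \<open>B\<close>, and it realizes
  the given type. To find \<open>D\<close> it suffices to prescribe the measures of the sets
  \<open>D i \<inter> A j \<inter> B k\<close>, because an atomless measure space can be cut into pieces of prescribed measure;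
  the formula
  \<open>prob (C i \<inter> A j) / n + [i = j] (prob (A i \<inter> B k) - prob (A i) / n)\<close> has the right marginals and is
  nonnegative when \<open>C\<close> is \<open>\<delta>\<close>-close to \<open>A\<close> (\<open>amalgamate_partitions\<close>).

  Finally the exceptional realizations form a finite union of closed sets, one for each pair
  \<open>(i, k)\<close> with \<open>A i \<inter> B k\<close> null. Each of them has empty interior, since exchanging a small part of
  \<open>B k\<close> with a small part of \<open>A i\<close> makes the intersection positive while moving \<open>B\<close> very little
  (\<open>nowhere_dense_missing_piece\<close>).
\<close>

section \<open>A real coordinate that generates the events\<close>

text \<open>Base 3 rather than base 2: the digits are only 0 and 1, so the contribution of the tail after a
  digit is less than one unit of that digit. The digits can therefore be read off by Borel
  conditions on the code, and the code separates points according to the sequence \<open>B\<close>, with no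
  exception for dyadic expansions.\<close>

definition ternary_code :: "(nat \<Rightarrow> 'a set) \<Rightarrow> 'a \<Rightarrow> real" where
  "ternary_code B x = (\<Sum>n. indicat_real (B n) x / 3 ^ n)"

lemma summable_ternary_code: "summable (\<lambda>n. indicat_real (B n) x / 3 ^ n)"
proof (rule summable_comparison_test')
  show "summable (\<lambda>n. (1/3::real) ^ n)" by (rule summable_geometric) simp
  show "norm (indicat_real (B n) x / 3 ^ n) \<le> (1/3) ^ n" if "0 \<le> n" for n
    by (simp add: indicator_def power_divide)
qed

lemma ternary_code_tail:
  "0 \<le> ternary_code B x - (\<Sum>i<n. indicat_real (B i) x / 3 ^ i)"
  "ternary_code B x - (\<Sum>i<n. indicat_real (B i) x / 3 ^ i) \<le> 3 / 2 / 3 ^ n"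
proof -
  let ?t = "\<lambda>i. indicat_real (B (i + n)) x / 3 ^ (i + n)"
  have eq: "ternary_code B x - (\<Sum>i<n. indicat_real (B i) x / 3 ^ i) = suminf ?t"
    unfolding ternary_code_def
    by (subst suminf_split_initial_segment[OF summable_ternary_code, of _ _ n]) simp
  have s: "summable ?t"
    using summable_ignore_initial_segment[OF summable_ternary_code] .
  have g: "(\<lambda>i. (1/3::real) ^ i * (1 / 3 ^ n)) sums (1 / (1 - 1/3) * (1 / 3 ^ n))"
    by (intro sums_mult2 geometric_sums) auto
  show "0 \<le> ternary_code B x - (\<Sum>i<n. indicat_real (B i) x / 3 ^ i)"
    unfolding eq by (intro suminf_nonneg s) auto
  have "suminf ?t \<le> (\<Sum>i. (1/3::real) ^ i * (1 / 3 ^ n))"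
    by (intro suminf_le s sums_summable[OF g])
       (auto simp: indicator_def power_add power_divide)
  then show "ternary_code B x - (\<Sum>i<n. indicat_real (B i) x / 3 ^ i) \<le> 3 / 2 / 3 ^ n"
    unfolding eq sums_unique[OF g, symmetric] by simp
qed

lemma ternary_code_digit:
  "x \<in> B n \<longleftrightarrow> 1 / 3 ^ n \<le> ternary_code B x - (\<Sum>i<n. indicat_real (B i) x / 3 ^ i)"
proof -
  define e :: real where "e = 1 / 3 ^ n"
  have e: "0 < e" "3 / 2 / 3 ^ Suc n = e / 2" "indicat_real (B n) x / 3 ^ n = indicat_real (B n) x * e"
    by (auto simp: e_def)
  show ?thesis
    using ternary_code_tail[of B x "Suc n"] e(1)
    unfolding sum.lessThan_Suc e e_def[symmetric] by (cases "x \<in> B n") (simp_all add: field_simps)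
qed

text \<open>Membership in a union of an initial segment of the sequence is a half-line condition on the code.
  This is what later turns the pieces of a finite disjoint family into intervals.\<close>

lemma ternary_code_initial:
  "(\<exists>j<i. x \<in> B j) \<longleftrightarrow> 2 / 3 ^ i < ternary_code B x"
proof
  assume "\<exists>j<i. x \<in> B j"
  then obtain j where j: "j < i" "x \<in> B j" by auto
  have "(2::real) / 3 ^ i < 3 / 3 ^ i" by (simp add: divide_strict_right_mono)
  also have "\<dots> \<le> 1 / 3 ^ j"
  proof -
    have "(3::real) ^ Suc j \<le> 3 ^ i" using j by (intro power_increasing) auto
    then show ?thesis by (simp add: field_simps)
  qed
  also have "\<dots> \<le> ternary_code B x - (\<Sum>i<j. indicat_real (B i) x / 3 ^ i)"
    using ternary_code_digit[of x B j] j by simp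
  also have "\<dots> \<le> ternary_code B x" by (simp add: sum_nonneg)
  finally show "2 / 3 ^ i < ternary_code B x" .
next
  assume a: "2 / 3 ^ i < ternary_code B x"
  show "\<exists>j<i. x \<in> B j"
  proof (rule ccontr)
    assume "\<not> (\<exists>j<i. x \<in> B j)"
    then have "ternary_code B x \<le> 3 / 2 / 3 ^ i"
      using ternary_code_tail(2)[of B x i] by simp
    also have "\<dots> < 2 / 3 ^ i" by (rule divide_strict_right_mono) auto
    finally show False using a by simp
  qed
qed

lemma ternary_code_measurable:
  assumes "\<And>n. B n \<in> sets N"
  shows "ternary_code B \<in> borel_measurable N"
proof -
  have [measurable]: "B n \<in> sets N" for n by fact
  show ?thesis unfolding ternary_code_def by measurable
qed

text \<open>By induction on \<open>n\<close>, \<open>B n\<close> is a Borel condition on the code: its digit is read off after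
  subtracting the contribution of the earlier ones.\<close>

lemma sigma_sets_subset_ternary_code_vimage:
  assumes "\<And>n. B n \<subseteq> X"
  shows "sigma_sets X (range B) \<subseteq> {ternary_code B -` C \<inter> X | C. C \<in> sets borel}"
proof -
  let ?V = "vimage_algebra X (ternary_code B) borel"
  have h[measurable]: "ternary_code B \<in> borel_measurable ?V"
    by (rule measurable_vimage_algebra1) auto
  have B: "B n \<in> sets ?V" for n
  proof (induction n rule: less_induct)
    case (less n)
    have [measurable]: "(\<lambda>x. \<Sum>i<n. indicat_real (B i) x / 3 ^ i) \<in> borel_measurable ?V"
      using less by (intro borel_measurable_sum borel_measurable_divide borel_measurable_indicator) auto
    have "B n = {x \<in> space ?V. 1 / 3 ^ n \<le> ternary_code B x - (\<Sum>i<n. indicat_real (B i) x / 3 ^ i)}"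
      using assms[of n] by (auto simp: ternary_code_digit[symmetric])
    also have "\<dots> \<in> sets ?V" by measurable
    finally show ?case .
  qed
  have "sigma_sets (space ?V) (range B) \<subseteq> sets ?V"
    using B by (intro sets.sigma_sets_subset) auto
  then show ?thesis by (simp add: sets_vimage_algebra2)
qed

lemma standard_borel_countably_generated:
  assumes "standard_borel M"
  shows "\<exists>U :: nat \<Rightarrow> 'a set. range U \<subseteq> sets M \<and> sets M = sigma_sets (space M) (range U)"
proof -
  obtain T where T: "topspace T = space M" "second_countable T"
    "sets M = sigma_sets (space M) {U. openin T U}"
    using assms by (auto simp: standard_borel_def)
  then obtain \<B> where B: "countable \<B>" "\<And>V. V \<in> \<B> \<Longrightarrow> openin T V"
    "\<And>U x. openin T U \<Longrightarrow> x \<in> U \<Longrightarrow> \<exists>V\<in>\<B>. x \<in> V \<and> V \<subseteq> U"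
    unfolding second_countable_def by metis
  define U where "U = from_nat_into (insert {} \<B>)"
  have r: "range U = insert {} \<B>"
    unfolding U_def using B(1) by (intro range_from_nat_into) auto
  have "W \<in> sigma_sets (space M) (range U)" if "openin T W" for W
  proof -
    have "W = \<Union>{V \<in> \<B>. V \<subseteq> W}" using B(3)[OF that] by blast
    also have "\<dots> \<in> sigma_sets (space M) (range U)"
      using countable_subset[OF _ B(1)]
      by (intro sigma_sets_UNION[where A = "range U"]) (auto simp: r)
    finally show ?thesis .
  qed
  then have "sets M \<subseteq> sigma_sets (space M) (range U)"
    unfolding T(3) by (intro sigma_sets_mono) auto
  moreover have sub: "range U \<subseteq> sets M"
    unfolding r T(3) using B(2) by (auto intro: sigma_sets.intros)
  moreover have "sigma_sets (space M) (range U) \<subseteq> sets M"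
    using sub by (intro sets.sigma_sets_subset)
  ultimately show ?thesis by blast
qed

context prob_space
begin

lemma prob_eq_imp_AE:
  assumes "A \<in> events" "B \<in> events" "A \<subseteq> B" "prob A = prob B"
  shows "AE x in M. x \<in> A \<longleftrightarrow> x \<in> B"
proof -
  have "prob (B - A) = 0" using assms by (simp add: finite_measure_Diff)
  then have "AE x in M. x \<notin> B - A" using assms by (subst (asm) prob_eq_0) auto
  then show ?thesis by (rule AE_mp) (use assms(3) in auto)
qed

text \<open>A map to the unit interval that carries the measure to Lebesgue measure and induces an isomorphism
  of the measure algebras.\<close>

definition uniform_coordinate :: "('a \<Rightarrow> real) \<Rightarrow> bool" where
  "uniform_coordinate f \<longleftrightarrow> f \<in> borel_measurable M \<and>
     (\<forall>y. prob {x \<in> space M. f x \<le> y} = max 0 (min 1 y)) \<and>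
     (\<forall>S\<in>events. \<exists>D\<in>sets borel. AE x in M. x \<in> S \<longleftrightarrow> f x \<in> D)"

text \<open>Composing a generating real function with its own distribution function makes the distribution
  uniform. The distribution function is continuous because the measure has no atoms: a fibre
  of \<open>h\<close> contains no event except itself and the empty set. It need not be injective, but the intervals
  that it collapses have null preimages, so no event is lost up to null sets.\<close>

lemma cdf_uniform_coordinate:
  assumes h[measurable]: "h \<in> borel_measurable M"
    and gen: "\<And>S. S \<in> events \<Longrightarrow> \<exists>C\<in>sets borel. S = h -` C \<inter> space M"
    and atomless: "atomless M"
    and F: "F = cdf (distr M borel h)"
  shows "uniform_coordinate (\<lambda>x. F (h x))"
    and "\<And>t. AE x in M. h x \<le> t \<longleftrightarrow> F (h x) \<le> F t"
proof -
  interpret D: real_distribution "distr M borel h"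
    using h by (simp add: real_distribution_distr)
  have Feq: "F t = prob {x \<in> space M. h x \<le> t}" for t
    unfolding F cdf_def by (subst measure_distr) (auto intro!: arg_cong[where f=prob])
  have null: "prob (h -` {t} \<inter> space M) = 0" for t
  proof (rule ccontr)
    assume "prob (h -` {t} \<inter> space M) \<noteq> 0"
    then have "0 < prob (h -` {t} \<inter> space M)" by (simp add: zero_less_measure_iff)
    then obtain S where S: "S \<in> events" "S \<subseteq> h -` {t} \<inter> space M" "0 < prob S"
        "prob S < prob (h -` {t} \<inter> space M)"
      using atomless unfolding atomless_def by (meson borel_singleton h measurable_sets sets.empty_sets)
    obtain C where C: "S = h -` C \<inter> space M" using gen[OF S(1)] by auto
    show False
    proof (cases "t \<in> C")
      case True
      then have "S = h -` {t} \<inter> space M" using S(2) C by auto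
      then show False using S by simp
    next
      case False
      then have "S = {}" using S(2) C by auto
      then show False using S by simp
    qed
  qed
  have cont: "isCont F t" for t
    unfolding F by (subst D.isCont_cdf) (simp add: measure_distr null)
  have mono: "s \<le> t \<Longrightarrow> F s \<le> F t" for s t
    unfolding F by (rule D.cdf_nondecreasing)
  have [measurable]: "F \<in> borel_measurable borel"
    using mono by (intro borel_measurable_mono) (auto simp: mono_def)
  have F1: "F t \<le> 1" for t unfolding F using D.cdf_bounded_prob by simp
  have F0: "0 \<le> F t" for t unfolding F by (rule D.cdf_nonneg)
  have ivt: "\<exists>t. F t = y" if y: "0 < y" "y < 1" for y
  proof -
    have "eventually (\<lambda>t. F t < y) at_bot"
      using order_tendstoD(2)[OF D.cdf_lim_at_bot, of y] y unfolding F by simp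
    then obtain s where s: "F s < y" using eventually_happens' trivial_limit_at_bot_linorder by blast
    have "eventually (\<lambda>t. y < F t) at_top"
      using order_tendstoD(1)[OF D.cdf_lim_at_top_prob, of y] y unfolding F by simp
    then obtain u where u: "y < F u" using eventually_happens' trivial_limit_at_top_linorder by blast
    have "s \<le> u" using mono[of u s] s u by linarith
    then show ?thesis using IVT[of F s y u] s u cont by auto
  qed
  have le: "prob {x \<in> space M. F (h x) \<le> y} \<le> y'" if y': "y < y'" "0 < y'" "y' < 1" for y y'
  proof -
    obtain t where t: "F t = y'" using ivt y' by blast
    have "prob {x \<in> space M. F (h x) \<le> y} \<le> prob {x \<in> space M. h x \<le> t}"
    proof (rule finite_measure_mono)
      show "{x \<in> space M. F (h x) \<le> y} \<subseteq> {x \<in> space M. h x \<le> t}"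
      proof safe
        fix x assume "F (h x) \<le> y"
        then show "h x \<le> t" using mono[of t "h x"] t y'(1) by linarith
      qed
    qed simp
    then show ?thesis using Feq t by simp
  qed
  have unif: "prob {x \<in> space M. F (h x) \<le> y} = max 0 (min 1 y)" for y
  proof (cases "1 \<le> y")
    case True
    then have "{x \<in> space M. F (h x) \<le> y} = space M" using F1 order_trans by blast
    then show ?thesis using True prob_space by simp
  next
    case False
    have "prob {x \<in> space M. F (h x) \<le> y} \<le> max 0 y"
      by (rule dense_ge_bounded[where x = 1]) (use False le in auto)
    moreover have "max 0 y \<le> prob {x \<in> space M. F (h x) \<le> y}"
    proof (cases "0 < y")
      case True
      then obtain t where t: "F t = y" using ivt False by force
      have "prob {x \<in> space M. h x \<le> t} \<le> prob {x \<in> space M. F (h x) \<le> y}"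
        using mono t by (intro finite_measure_mono) auto
      then show ?thesis using Feq t True by simp
    qed simp
    ultimately show ?thesis using False by simp
  qed
  show cut: "AE x in M. h x \<le> t \<longleftrightarrow> F (h x) \<le> F t" for t
  proof -
    have "AE x in M. x \<in> {x \<in> space M. h x \<le> t} \<longleftrightarrow> x \<in> {x \<in> space M. F (h x) \<le> F t}"
    proof (rule prob_eq_imp_AE)
      show "prob {x \<in> space M. h x \<le> t} = prob {x \<in> space M. F (h x) \<le> F t}"
        using unif[of "F t"] F0[of t] F1[of t] Feq[of t] by simp
    qed (use mono in auto)
    then show ?thesis using AE_space by eventually_elim auto
  qed
  have ex: "\<exists>D\<in>sets borel. AE x in M. h x \<in> C \<longleftrightarrow> F (h x) \<in> D" if "C \<in> sets borel" for C
  proof -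
    have "C \<in> sigma_sets UNIV (range atMost)" using that by (subst (asm) borel_eq_atMost) simp
    then show ?thesis
    proof induction
      case (Basic a)
      then obtain t where "a = {..t}" by auto
      then show ?case using cut[of t] by (intro bexI[of _ "{..F t}"]) auto
    next
      case Empty
      then show ?case by (intro bexI[of _ "{}"]) auto
    next
      case (Compl a)
      then obtain D where "D \<in> sets borel" "AE x in M. h x \<in> a \<longleftrightarrow> F (h x) \<in> D" by auto
      then show ?case by (intro bexI[of _ "UNIV - D"]) auto
    next
      case (Union a)
      then obtain D where D: "\<And>i. D i \<in> sets borel" "\<And>i. AE x in M. h x \<in> a i \<longleftrightarrow> F (h x) \<in> D i"
        by metis
      from D(2) have "AE x in M. \<forall>i::nat. h x \<in> a i \<longleftrightarrow> F (h x) \<in> D i" by (subst AE_all_countable) simp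
      then have "AE x in M. h x \<in> (\<Union>i. a i) \<longleftrightarrow> F (h x) \<in> (\<Union>i. D i)" by eventually_elim auto
      then show ?case using D(1) by (intro bexI[of _ "\<Union>i. D i"]) auto
    qed
  qed
  have "\<exists>D\<in>sets borel. AE x in M. x \<in> S \<longleftrightarrow> F (h x) \<in> D" if S: "S \<in> events" for S
  proof -
    obtain C where C: "C \<in> sets borel" "S = h -` C \<inter> space M" using gen[OF S] by auto
    obtain D where D: "D \<in> sets borel" "AE x in M. h x \<in> C \<longleftrightarrow> F (h x) \<in> D" using ex[OF C(1)] by auto
    have "AE x in M. x \<in> S \<longleftrightarrow> F (h x) \<in> D"
      using D(2) AE_space by eventually_elim (simp add: C(2))
    then show ?thesis using D(1) by auto
  qed
  then show "uniform_coordinate (\<lambda>x. F (h x))"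
    unfolding uniform_coordinate_def using unif by auto
qed

text \<open>Placing the given sets at the front of a generating sequence before coding makes the coordinate
  send each union of an initial segment to an upper interval, whose left end is then forced by its
  measure.\<close>

lemma uniform_coordinate_initial_segments:
  fixes P :: "nat \<Rightarrow> 'a set"
  assumes M: "standard_probability_space M"
    and P: "\<And>i. i < N \<Longrightarrow> P i \<in> events"
  shows "\<exists>f. uniform_coordinate f \<and>
    (\<forall>i\<le>N. AE x in M. (\<exists>j<i. x \<in> P j) \<longleftrightarrow> 1 - prob (\<Union>j<i. P j) < f x)"
proof -
  have sb: "standard_borel M" using M by (simp add: standard_probability_space_def)
  obtain U :: "nat \<Rightarrow> 'a set" where U: "range U \<subseteq> events" "events = sigma_sets (space M) (range U)"
    using standard_borel_countably_generated[OF sb] by metis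
  define B where "B = (\<lambda>i. if i < N then P i else U (i - N))"
  have B: "B i \<in> events" for i using P U(1) by (auto simp: B_def)
  have "U i = B (i + N)" for i by (simp add: B_def)
  then have "events \<subseteq> sigma_sets (space M) (range B)"
    by (subst U(2)) (intro sigma_sets_subseteq, auto)
  also have "\<dots> \<subseteq> {ternary_code B -` C \<inter> space M | C. C \<in> sets borel}"
    using B by (intro sigma_sets_subset_ternary_code_vimage sets.sets_into_space)
  finally have gen: "\<exists>C\<in>sets borel. S = ternary_code B -` C \<inter> space M" if "S \<in> events" for S
    using that by blast
  have h[measurable]: "ternary_code B \<in> borel_measurable M"
    using B by (rule ternary_code_measurable)
  define F where "F = cdf (distr M borel (ternary_code B))"
  have at: "atomless M" using M by (simp add: standard_probability_space_def)
  have F: "uniform_coordinate (\<lambda>x. F (ternary_code B x))"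
      "\<And>t. AE x in M. ternary_code B x \<le> t \<longleftrightarrow> F (ternary_code B x) \<le> F t"
    by (rule cdf_uniform_coordinate[OF h gen at F_def], assumption)+
  show ?thesis
  proof (intro exI[of _ "\<lambda>x. F (ternary_code B x)"] conjI allI impI)
    show "uniform_coordinate (\<lambda>x. F (ternary_code B x))" by (rule F(1))
    fix i assume i: "i \<le> N"
    have P': "(\<exists>j<i. x \<in> P j) \<longleftrightarrow> 2 / 3 ^ i < ternary_code B x" for x
    proof -
      have "B j = P j" if "j < i" for j using i that by (simp add: B_def)
      then show ?thesis by (subst ternary_code_initial[symmetric]) auto
    qed
    have UP: "(\<Union>j<i. P j) \<in> events" using P i by auto
    have "F (2 / 3 ^ i) = prob {x \<in> space M. ternary_code B x \<le> 2 / 3 ^ i}"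
      unfolding F_def cdf_def by (subst measure_distr) (auto intro!: arg_cong[where f=prob])
    also have "{x \<in> space M. ternary_code B x \<le> 2 / 3 ^ i} = space M - (\<Union>j<i. P j)"
      by (auto simp: not_less[symmetric] P'[symmetric])
    also have "prob \<dots> = 1 - prob (\<Union>j<i. P j)" by (rule prob_compl[OF UP])
    finally have F': "F (2 / 3 ^ i) = 1 - prob (\<Union>j<i. P j)" .
    show "AE x in M. (\<exists>j<i. x \<in> P j) \<longleftrightarrow> 1 - prob (\<Union>j<i. P j) < F (ternary_code B x)"
      using F(2)[of "2 / 3 ^ i"] by eventually_elim (simp only: P' F' not_le[symmetric, where 'a = real])
  qed
qed

section \<open>Homogeneity of the measure algebra\<close>

lemma malg_class_eq_iff_AE:
  assumes "S \<in> events" "T \<in> events"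
  shows "malg_class M S = malg_class M T \<longleftrightarrow> (AE x in M. x \<in> S \<longleftrightarrow> x \<in> T)"
proof -
  have "malg_class M S = malg_class M T \<longleftrightarrow> (AE x in M. x \<notin> sym_diff S T)"
    using assms by (simp add: malg_class_eq_iff prob_eq_0)
  also have "\<dots> \<longleftrightarrow> (AE x in M. x \<in> S \<longleftrightarrow> x \<in> T)"
    by (intro AE_cong) auto
  finally show ?thesis .
qed

lemma malg_classE:
  assumes "a \<in> malg M"
  obtains S where "S \<in> events" "a = malg_class M S"
  using malg_rep[OF assms] that by metis

lemma uniform_coordinate_distr_eq:
  assumes f: "uniform_coordinate f" and g: "uniform_coordinate g"
  shows "distr M borel f = distr M borel g"
proof -
  have [measurable]: "f \<in> borel_measurable M" "g \<in> borel_measurable M"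
    using f g by (auto simp: uniform_coordinate_def)
  have cdf: "cdf (distr M borel k) y = max 0 (min 1 y)" if "uniform_coordinate k" for k y
  proof -
    have [measurable]: "k \<in> borel_measurable M" using that by (simp add: uniform_coordinate_def)
    have "cdf (distr M borel k) y = prob {x \<in> space M. k x \<le> y}"
      unfolding cdf_def by (subst measure_distr) (auto intro!: arg_cong[where f=prob])
    then show ?thesis using that by (simp add: uniform_coordinate_def)
  qed
  show ?thesis
    by (rule cdf_unique) (auto simp: real_distribution_distr cdf[OF f] cdf[OF g])
qed

text \<open>Both coordinates identify the measure algebra with that of Lebesgue measure on the unit interval;
  the automorphism is one identification followed by the inverse of the other.\<close>

lemma automorphism_of_coordinates:
  assumes f: "uniform_coordinate f" and g: "uniform_coordinate g"
  obtains w where "w \<in> malg_Aut M"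
    "\<And>D. D \<in> sets borel \<Longrightarrow>
       w (malg_class M (f -` D \<inter> space M)) = malg_class M (g -` D \<inter> space M)"
proof -
  have fm[measurable]: "f \<in> borel_measurable M" and gm[measurable]: "g \<in> borel_measurable M"
    using f g by (auto simp: uniform_coordinate_def)
  let ?f = "\<lambda>D. f -` D \<inter> space M" and ?g = "\<lambda>D. g -` D \<inter> space M"
  have ev: "?f D \<in> events" "?g D \<in> events" if "D \<in> sets borel" for D
    using that by (auto intro: measurable_sets)
  have rep: "\<exists>D\<in>sets borel. a = malg_class M (k -` D \<inter> space M)"
    if k: "uniform_coordinate k" and a: "a \<in> malg M" for k a
  proof -
    have km: "k \<in> borel_measurable M" using k by (simp add: uniform_coordinate_def)
    obtain S where S: "S \<in> events" "a = malg_class M S" using malg_classE[OF a] .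
    obtain D where D: "D \<in> sets borel" "AE x in M. x \<in> S \<longleftrightarrow> k x \<in> D"
      using k S unfolding uniform_coordinate_def by blast
    have "AE x in M. x \<in> S \<longleftrightarrow> x \<in> k -` D \<inter> space M"
      using D(2) AE_space by eventually_elim auto
    then have "a = malg_class M (k -` D \<inter> space M)"
      using S D km by (simp add: malg_class_eq_iff_AE measurable_sets)
    then show ?thesis using D by auto
  qed
  have sd: "sym_diff (k -` D \<inter> space M) (k -` E \<inter> space M) = k -` (sym_diff D E) \<inter> space M"
    for k :: "'a \<Rightarrow> real" and D E by auto
  have meas: "prob (?f D) = prob (?g D)" if "D \<in> sets borel" for D
    using uniform_coordinate_distr_eq[OF f g] that measure_distr[OF fm that] measure_distr[OF gm that]
    by simp
  have dist: "malg_dist M (malg_class M (?f D)) (malg_class M (?f E))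
      = malg_dist M (malg_class M (?g D)) (malg_class M (?g E))"
    if "D \<in> sets borel" "E \<in> sets borel" for D E
  proof -
    have "sym_diff D E \<in> sets borel" using that by simp
    then show ?thesis using meas that by (simp only: malg_dist_class ev sd)
  qed
  interpret MS: Metric_space "malg M" "malg_dist M" by (rule Metric_space_malg)
  define w where "w = (\<lambda>a\<in>malg M. malg_class M (?g (SOME D. D \<in> sets borel \<and> a = malg_class M (?f D))))"
  have w: "w (malg_class M (?f D)) = malg_class M (?g D)" if D: "D \<in> sets borel" for D
  proof -
    let ?a = "malg_class M (?f D)"
    define E where "E = (SOME E. E \<in> sets borel \<and> ?a = malg_class M (?f E))"
    have E: "E \<in> sets borel \<and> ?a = malg_class M (?f E)"
      unfolding E_def by (rule someI) (use D in auto)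
    have "malg_dist M (malg_class M (?g E)) (malg_class M (?g D)) = 0"
      using dist[of E D] E D MS.zero[of ?a ?a] malg_class_in_malg[OF ev(1)[OF D]] by simp
    then have "malg_class M (?g E) = malg_class M (?g D)"
      using MS.zero malg_class_in_malg ev E D by simp
    then show ?thesis
      using malg_class_in_malg[OF ev(1)[OF D]] by (simp add: w_def E_def)
  qed
  have wd: "malg_dist M (w a) (w b) = malg_dist M a b" if ab: "a \<in> malg M" "b \<in> malg M" for a b
  proof -
    obtain D E where "D \<in> sets borel" "a = malg_class M (?f D)" "E \<in> sets borel" "b = malg_class M (?f E)"
      using rep[OF f] ab by metis
    then show ?thesis using dist[of D E] w by simp
  qed
  have wm: "w a \<in> malg M" if "a \<in> malg M" for a
    using rep[OF f that] w malg_class_in_malg ev by auto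
  have "w \<in> malg_Aut M"
    unfolding malg_Aut_def
  proof (intro CollectI conjI ballI)
    show "w \<in> extensional (malg M)" by (simp add: w_def)
    show "bij_betw w (malg M) (malg M)"
      unfolding bij_betw_def
    proof
      show "inj_on w (malg M)"
        by (rule inj_onI) (metis wd wm MS.zero)
      have "a \<in> w ` malg M" if a: "a \<in> malg M" for a
      proof -
        obtain D where D: "D \<in> sets borel" "a = malg_class M (?g D)" using rep[OF g a] by auto
        then have "a = w (malg_class M (?f D))" using w by simp
        then show ?thesis using malg_class_in_malg ev D by blast
      qed
      then show "w ` malg M = malg M" using wm by auto
    qed
    show "w (malg_empty M) = malg_empty M"
      using w[of "{}"] by (simp add: malg_empty_def)
    fix a b assume ab: "a \<in> malg M" "b \<in> malg M"
    show "malg_dist M (w a) (w b) = malg_dist M a b" by (rule wd[OF ab])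
    obtain D E where DE: "D \<in> sets borel" "a = malg_class M (?f D)" "E \<in> sets borel" "b = malg_class M (?f E)"
      using rep[OF f] ab by metis
    have "w (malg_sdiff M a b) = w (malg_class M (?f (sym_diff D E)))"
      using DE by (simp only: malg_sdiff_class ev sd)
    also have "\<dots> = malg_class M (?g (sym_diff D E))" using DE by (intro w) auto
    also have "\<dots> = malg_sdiff M (w a) (w b)"
      using DE by (simp only: malg_sdiff_class ev sd w)
    finally show "w (malg_sdiff M a b) = malg_sdiff M (w a) (w b)" .
  qed
  then show ?thesis using that w by blast
qed

text \<open>In coordinates adapted to \<open>P\<close> and to \<open>Q\<close> the corresponding pieces become the same interval,
  because the ends of the intervals depend only on the measures of the pieces.\<close>

lemma automorphism_of_disjoint_sequences:
  fixes P Q :: "nat \<Rightarrow> 'a set"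
  assumes M: "standard_probability_space M"
    and P: "\<And>i. i < N \<Longrightarrow> P i \<in> events" "disjoint_family_on P {..<N}"
    and Q: "\<And>i. i < N \<Longrightarrow> Q i \<in> events" "disjoint_family_on Q {..<N}"
    and PQ: "\<And>i. i < N \<Longrightarrow> prob (P i) = prob (Q i)"
  obtains w where "w \<in> malg_Aut M" "\<And>i. i < N \<Longrightarrow> w (malg_class M (P i)) = malg_class M (Q i)"
proof -
  define y where "y R i = 1 - prob (\<Union>j<i. R j)" for R :: "nat \<Rightarrow> 'a set" and i :: nat
  have yP: "y P i = y Q i" if "i \<le> N" for i
  proof -
    have "prob (\<Union>j<i. P j) = (\<Sum>j<i. prob (P j))"
      using P that by (intro finite_measure_finite_Union) (auto intro: disjoint_family_on_mono)
    moreover have "prob (\<Union>j<i. Q j) = (\<Sum>j<i. prob (Q j))"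
      using Q that by (intro finite_measure_finite_Union) (auto intro: disjoint_family_on_mono)
    ultimately show ?thesis using PQ that by (simp add: y_def)
  qed
  obtain f where f: "uniform_coordinate f" "\<And>i. i \<le> N \<Longrightarrow> AE x in M. (\<exists>j<i. x \<in> P j) \<longleftrightarrow> y P i < f x"
    using uniform_coordinate_initial_segments[of N P, OF M P(1), folded y_def] by auto
  obtain g where g: "uniform_coordinate g" "\<And>i. i \<le> N \<Longrightarrow> AE x in M. (\<exists>j<i. x \<in> Q j) \<longleftrightarrow> y Q i < g x"
    using uniform_coordinate_initial_segments[of N Q, OF M Q(1), folded y_def] by auto
  obtain w where w: "w \<in> malg_Aut M" "\<And>D. D \<in> sets borel \<Longrightarrow>
       w (malg_class M (f -` D \<inter> space M)) = malg_class M (g -` D \<inter> space M)"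
    using automorphism_of_coordinates[OF f(1) g(1)] by blast
  \<comment> \<open>The intervals run downwards: the union of the first \<open>i\<close> pieces is the part above \<open>y R i\<close>.\<close>
  have piece: "malg_class M (R i) = malg_class M (k -` {y R (Suc i)<..y R i} \<inter> space M)"
    if k: "uniform_coordinate k" "\<And>i. i \<le> N \<Longrightarrow> AE x in M. (\<exists>j<i. x \<in> R j) \<longleftrightarrow> y R i < k x"
      and R: "\<And>i. i < N \<Longrightarrow> R i \<in> events" "disjoint_family_on R {..<N}" and i: "i < N"
    for R :: "nat \<Rightarrow> 'a set" and k i
  proof -
    have [measurable]: "k \<in> borel_measurable M" using k by (simp add: uniform_coordinate_def)
    have *: "x \<in> R i \<longleftrightarrow> (\<exists>j<Suc i. x \<in> R j) \<and> \<not> (\<exists>j<i. x \<in> R j)" for x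
      using R(2) i unfolding disjoint_family_on_def less_Suc_eq
      by (metis IntI emptyE lessThan_iff less_irrefl order.strict_trans)
    have "AE x in M. x \<in> R i \<longleftrightarrow> x \<in> k -` {y R (Suc i)<..y R i} \<inter> space M"
      using k(2)[OF less_imp_le[OF i]] k(2)[OF Suc_leI[OF i]] AE_space
      by eventually_elim (subst *, auto)
    then show ?thesis using R i by (subst malg_class_eq_iff_AE) auto
  qed
  show ?thesis
  proof (rule that[OF w(1)])
    fix i assume i: "i < N"
    show "w (malg_class M (P i)) = malg_class M (Q i)"
      using piece[OF f P i] piece[OF g Q i] yP[of i] yP[of "Suc i"] i w(2) by simp
  qed
qed

lemma automorphism_of_disjoint_families:
  assumes M: "standard_probability_space M" and I: "finite I"
    and P: "\<And>i. i \<in> I \<Longrightarrow> P i \<in> events" "disjoint_family_on P I"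
    and Q: "\<And>i. i \<in> I \<Longrightarrow> Q i \<in> events" "disjoint_family_on Q I"
    and PQ: "\<And>i. i \<in> I \<Longrightarrow> prob (P i) = prob (Q i)"
  obtains w where "w \<in> malg_Aut M" "\<And>i. i \<in> I \<Longrightarrow> w (malg_class M (P i)) = malg_class M (Q i)"
proof -
  obtain e where e: "bij_betw e {..<card I} I"
    using ex_bij_betw_nat_finite[OF I] by (auto simp: atLeast0LessThan)
  have eI: "e i \<in> I" if "i < card I" for i using e that by (auto simp: bij_betw_def)
  have dis: "disjoint_family_on (\<lambda>i. R (e i)) {..<card I}" if "disjoint_family_on R I" for R :: "_ \<Rightarrow> 'a set"
    using that e eI unfolding disjoint_family_on_def bij_betw_def inj_on_def by blast
  obtain w where w: "w \<in> malg_Aut M"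
      "\<And>i. i < card I \<Longrightarrow> w (malg_class M (P (e i))) = malg_class M (Q (e i))"
    using automorphism_of_disjoint_sequences[OF M, of "card I" "\<lambda>i. P (e i)" "\<lambda>i. Q (e i)"]
      P Q PQ dis eI by metis
  have "w (malg_class M (P i)) = malg_class M (Q i)" if i: "i \<in> I" for i
  proof -
    obtain k where "k < card I" "i = e k" using e i by (auto simp: bij_betw_def)
    then show ?thesis using w(2) by simp
  qed
  then show ?thesis using that w(1) by blast
qed

lemma malg_Aut_class_Union:
  assumes w: "w \<in> malg_Aut M" and J: "finite J"
    and P: "\<And>i. i \<in> J \<Longrightarrow> P i \<in> events" "disjoint_family_on P J"
    and Q: "\<And>i. i \<in> J \<Longrightarrow> Q i \<in> events" "disjoint_family_on Q J"
    and PQ: "\<And>i. i \<in> J \<Longrightarrow> w (malg_class M (P i)) = malg_class M (Q i)"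
  shows "w (malg_class M (\<Union>i\<in>J. P i)) = malg_class M (\<Union>i\<in>J. Q i)"
  using J P Q PQ
proof (induction J)
  case empty
  then show ?case using w by (simp add: malg_Aut_def malg_empty_def)
next
  case (insert i J)
  have un: "(\<Union>j\<in>insert i J. R j) = sym_diff (R i) (\<Union>j\<in>J. R j)"
    if "disjoint_family_on R (insert i J)" for R :: "_ \<Rightarrow> 'a set"
  proof -
    have "R i \<inter> R j = {}" if "j \<in> J" for j
      using disjoint_family_onD[OF \<open>disjoint_family_on R (insert i J)\<close>, of i j] that insert.hyps
      by auto
    then show ?thesis by auto
  qed
  have IH: "w (malg_class M (\<Union>i\<in>J. P i)) = malg_class M (\<Union>i\<in>J. Q i)"
    using insert.prems by (intro insert.IH) (auto intro: disjoint_family_on_mono[OF subset_insertI])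
  have ev: "P i \<in> events" "Q i \<in> events" "(\<Union>i\<in>J. P i) \<in> events" "(\<Union>i\<in>J. Q i) \<in> events"
    using insert.prems insert.hyps by auto
  have "w (malg_class M (\<Union>j\<in>insert i J. P j))
      = w (malg_sdiff M (malg_class M (P i)) (malg_class M (\<Union>i\<in>J. P i)))"
    using ev by (simp only: un[OF insert.prems(2)] malg_sdiff_class)
  also have "\<dots> = malg_sdiff M (w (malg_class M (P i))) (w (malg_class M (\<Union>i\<in>J. P i)))"
    using w malg_class_in_malg ev by (simp add: malg_Aut_def)
  also have "\<dots> = malg_class M (\<Union>j\<in>insert i J. Q j)"
    using ev by (simp only: un[OF insert.prems(4)] malg_sdiff_class IH insert.prems(5) insertI1)
  finally show ?case .
qed

section \<open>Splitting and amalgamating partitions\<close>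

definition event_partition :: "'a set \<Rightarrow> nat \<Rightarrow> (nat \<Rightarrow> 'a set) \<Rightarrow> bool" where
  "event_partition S n T \<longleftrightarrow>
     (\<forall>i<n. T i \<in> events) \<and> disjoint_family_on T {..<n} \<and> (\<Union>i<n. T i) = S"

lemma event_partitionD:
  assumes "event_partition S n T"
  shows "i < n \<Longrightarrow> T i \<in> events" "disjoint_family_on T {..<n}" "(\<Union>i<n. T i) = S"
    "x \<in> S \<Longrightarrow> \<exists>i<n. x \<in> T i" "i < n \<Longrightarrow> x \<in> T i \<Longrightarrow> x \<in> S"
    "i < n \<Longrightarrow> j < n \<Longrightarrow> x \<in> T i \<Longrightarrow> x \<in> T j \<Longrightarrow> i = j"
  using assms unfolding event_partition_def disjoint_family_on_def by blast+

lemma sum_prob_event_partition: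
  assumes T: "event_partition S n T" and R: "R \<in> events"
  shows "(\<Sum>i<n. prob (T i \<inter> R)) = prob (S \<inter> R)"
proof -
  have "(\<Sum>i<n. prob (T i \<inter> R)) = prob (\<Union>i<n. T i \<inter> R)"
    using event_partitionD(1,2)[OF T] R
    by (intro finite_measure_finite_Union[symmetric]) (auto simp: disjoint_family_on_def)
  also have "(\<Union>i<n. T i \<inter> R) = S \<inter> R"
    using event_partitionD(3)[OF T] by auto
  finally show ?thesis .
qed

text \<open>The part of \<open>S\<close> where a coordinate adapted to \<open>S\<close> exceeds \<open>1 - r\<close> has measure \<open>r\<close>.\<close>

lemma exists_subevent_prob:
  assumes M: "standard_probability_space M"
    and S: "S \<in> events" and r: "0 \<le> r" "r \<le> prob S"
  obtains T where "T \<in> events" "T \<subseteq> S" "prob T = r"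
proof -
  obtain f where f1: "uniform_coordinate f"
    and "\<forall>i\<le>Suc 0. AE x in M. (\<exists>j<i. x \<in> S) \<longleftrightarrow> 1 - prob (\<Union>j<i. S) < f x"
    using uniform_coordinate_initial_segments[OF M, of "Suc 0" "\<lambda>_. S"] S by blast
  from this(2)[rule_format, of "Suc 0"] have "AE x in M. x \<in> S \<longleftrightarrow> 1 - prob S < f x"
    by (simp add: lessThan_Suc)
  note f = f1 this
  have [measurable]: "f \<in> borel_measurable M" "S \<in> events"
    using f S by (auto simp: uniform_coordinate_def)
  let ?L = "{x \<in> space M. f x \<le> 1 - r}"
  have "prob (S - ?L) = prob (space M - ?L)"
  proof (rule finite_measure_eq_AE)
    show "AE x in M. x \<in> S - ?L \<longleftrightarrow> x \<in> space M - ?L"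
      using f(2) AE_space by eventually_elim (use r in auto)
  qed auto
  also have "\<dots> = 1 - prob ?L" by (rule prob_compl) measurable
  also have "\<dots> = r" using f(1) r order_trans[OF r(2) prob_le_1] by (simp add: uniform_coordinate_def)
  finally show ?thesis by (intro that[of "S - ?L"]) auto
qed

lemma exists_event_partition_prob:
  fixes r :: "nat \<Rightarrow> real"
  assumes M: "standard_probability_space M"
    and "S \<in> events" "\<And>i. i < Suc n \<Longrightarrow> 0 \<le> r i" "(\<Sum>i<Suc n. r i) = prob S"
  shows "\<exists>T. event_partition S (Suc n) T \<and> (\<forall>i<Suc n. prob (T i) = r i)"
  using assms(2-)
proof (induction n arbitrary: S)
  case 0
  then show ?case
    by (intro exI[of _ "\<lambda>_. S"]) (auto simp: event_partition_def disjoint_family_on_def)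
next
  case (Suc n)
  have "0 \<le> (\<Sum>i<Suc n. r i)" using Suc.prems(2) by (intro sum_nonneg) auto
  then obtain U where U: "U \<in> events" "U \<subseteq> S" "prob U = r (Suc n)"
    using exists_subevent_prob[OF M Suc.prems(1), of "r (Suc n)"] Suc.prems(2)[of "Suc n"] Suc.prems(3)
    by auto
  have "prob (S - U) = (\<Sum>i<Suc n. r i)"
    using U Suc.prems by (simp add: finite_measure_Diff)
  then obtain T where T: "event_partition (S - U) (Suc n) T" "\<forall>i<Suc n. prob (T i) = r i"
    using Suc.IH[of "S - U"] Suc.prems U by auto
  have "event_partition S (Suc (Suc n)) (T(Suc n := U))"
    unfolding event_partition_def
  proof (intro conjI allI impI)
    show "(T(Suc n := U)) i \<in> events" if "i < Suc (Suc n)" for i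
      using that event_partitionD(1)[OF T(1)] U by (auto simp: less_Suc_eq)
    show "disjoint_family_on (T(Suc n := U)) {..<Suc (Suc n)}"
      unfolding disjoint_family_on_def
    proof (intro ballI impI equals0I)
      fix i j x
      assume "i \<in> {..<Suc (Suc n)}" "j \<in> {..<Suc (Suc n)}" "i \<noteq> j"
        and "x \<in> (T(Suc n := U)) i \<inter> (T(Suc n := U)) j"
      then show False
        using event_partitionD(6)[OF T(1), of i j x] event_partitionD(5)[OF T(1), of i x]
          event_partitionD(5)[OF T(1), of j x]
        by (cases "i = Suc n"; cases "j = Suc n") auto
    qed
    have "(\<Union>i<Suc (Suc n). (T(Suc n := U)) i) = U \<union> (\<Union>i<Suc n. T i)"
      by (auto simp: less_Suc_eq split: if_splits)
    then show "(\<Union>i<Suc (Suc n). (T(Suc n := U)) i) = S"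
      using event_partitionD(3)[OF T(1)] U by auto
  qed
  moreover have "\<forall>i<Suc (Suc n). prob ((T(Suc n := U)) i) = r i"
    using T(2) U(3) by (auto simp: less_Suc_eq)
  ultimately show ?case by blast
qed

lemma disjoint_family_on_Times:
  assumes "disjoint_family_on P I" "disjoint_family_on Q K"
  shows "disjoint_family_on (\<lambda>(i, k). P i \<inter> Q k) (I \<times> K)"
  unfolding disjoint_family_on_def
proof (intro ballI impI equals0I)
  fix p q x
  assume "p \<in> I \<times> K" "q \<in> I \<times> K" "p \<noteq> q"
    and x: "x \<in> (case p of (i, k) \<Rightarrow> P i \<inter> Q k) \<inter> (case q of (i, k) \<Rightarrow> P i \<inter> Q k)"
  then have "fst p \<noteq> fst q \<and> fst p \<in> I \<and> fst q \<in> I \<or> snd p \<noteq> snd q \<and> snd p \<in> K \<and> snd q \<in> K"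
    by (auto simp: prod_eq_iff)
  then show False
    using disjoint_family_onD[OF assms(1), of "fst p" "fst q"]
      disjoint_family_onD[OF assms(2), of "snd p" "snd q"] x
    by (auto simp: case_prod_beta)
qed

text \<open>The measures of the intersections determine a pair of partitions up to automorphism: map the
  pieces of the common refinement to each other.\<close>

lemma automorphism_of_partition_pairs:
  assumes M: "standard_probability_space M"
    and P: "event_partition (space M) n P" and Q: "event_partition (space M) n Q"
    and P': "event_partition (space M) n P'" and Q': "event_partition (space M) n Q'"
    and eq: "\<And>i k. i < n \<Longrightarrow> k < n \<Longrightarrow> prob (P i \<inter> Q k) = prob (P' i \<inter> Q' k)"
  obtains w where "w \<in> malg_Aut M"
    "\<And>i. i < n \<Longrightarrow> w (malg_class M (P i)) = malg_class M (P' i)"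
    "\<And>i. i < n \<Longrightarrow> w (malg_class M (Q i)) = malg_class M (Q' i)"
proof -
  let ?I = "{..<n} \<times> {..<n}"
  let ?F = "\<lambda>(i, k). P i \<inter> Q k" and ?F' = "\<lambda>(i, k). P' i \<inter> Q' k"
  have ev: "?F p \<in> events" "?F' p \<in> events" if "p \<in> ?I" for p
    using that P Q P' Q' by (auto dest: event_partitionD(1))
  have dis: "disjoint_family_on ?F ?I" "disjoint_family_on ?F' ?I"
    using P Q P' Q' by (simp_all add: disjoint_family_on_Times event_partition_def)
  obtain w where w: "w \<in> malg_Aut M" "\<And>p. p \<in> ?I \<Longrightarrow> w (malg_class M (?F p)) = malg_class M (?F' p)"
  proof (rule automorphism_of_disjoint_families[OF M, of ?I ?F ?F'])
    show "prob (?F p) = prob (?F' p)" if "p \<in> ?I" for p using that eq by auto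
  qed (use ev dis in auto)
  \<comment> \<open>Every piece of either partition is a union of pieces of the refinement: a row or a column.\<close>
  have un: "w (malg_class M (\<Union>p\<in>J. ?F p)) = malg_class M (\<Union>p\<in>J. ?F' p)" if "J \<subseteq> ?I" for J
    using that w ev finite_subset[OF that] disjoint_family_on_mono[OF that dis(1)]
      disjoint_family_on_mono[OF that dis(2)]
    by (intro malg_Aut_class_Union) auto
  show ?thesis
  proof (rule that[OF w(1)])
    fix i assume i: "i < n"
    have "(\<Union>p\<in>{i} \<times> {..<n}. ?F p) = P i" "(\<Union>p\<in>{i} \<times> {..<n}. ?F' p) = P' i"
      using event_partitionD(4)[OF Q] event_partitionD(5)[OF P i]
        event_partitionD(4)[OF Q'] event_partitionD(5)[OF P' i] by fastforce+
    then show "w (malg_class M (P i)) = malg_class M (P' i)"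
      using un[of "{i} \<times> {..<n}"] i by auto
    have "(\<Union>p\<in>{..<n} \<times> {i}. ?F p) = Q i" "(\<Union>p\<in>{..<n} \<times> {i}. ?F' p) = Q' i"
      using event_partitionD(4)[OF P] event_partitionD(5)[OF Q i]
        event_partitionD(4)[OF P'] event_partitionD(5)[OF Q' i] by fastforce+
    then show "w (malg_class M (Q i)) = malg_class M (Q' i)"
      using un[of "{..<n} \<times> {i}"] i by auto
  qed
qed

text \<open>Each set \<open>A j \<inter> B k\<close> is cut into pieces of measure \<open>t i j k\<close>, and \<open>D i\<close> collects the pieces with
  index \<open>i\<close>. The table \<open>t\<close> spreads \<open>C i \<inter> A j\<close> evenly over the \<open>n\<close> pieces of \<open>B\<close> and corrects the
  diagonal \<open>i = j\<close> so that summing over \<open>j\<close> gives \<open>prob (A i \<inter> B k)\<close>; the corrections cancel in the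
  sum over \<open>k\<close> since \<open>B\<close> is a partition. The hypothesis \<open>close\<close> keeps the diagonal entries
  nonnegative.\<close>

lemma amalgamate_partitions:
  assumes M: "standard_probability_space M"
    and A: "event_partition (space M) n A" and B: "event_partition (space M) n B"
    and C: "event_partition (space M) n C"
    and CA: "\<And>i. i < n \<Longrightarrow> prob (C i) = prob (A i)"
    and BA: "\<And>i. i < n \<Longrightarrow> prob (B i) = prob (A i)"
    and close: "\<And>i k. i < n \<Longrightarrow> k < n \<Longrightarrow> prob (A i - C i) \<le> prob (A i \<inter> B k)"
  obtains D where "event_partition (space M) n D"
    "\<And>i k. i < n \<Longrightarrow> k < n \<Longrightarrow> prob (D i \<inter> B k) = prob (A i \<inter> B k)"
    "\<And>i j. i < n \<Longrightarrow> j < n \<Longrightarrow> prob (D i \<inter> A j) = prob (C i \<inter> A j)"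
proof -
  have n: "0 < n" using event_partitionD(3)[OF A] not_empty by (cases n) auto
  note ev = event_partitionD(1)[OF A] event_partitionD(1)[OF B] event_partitionD(1)[OF C]
  have sp: "space M \<inter> S = S" if "S \<in> events" for S using sets.sets_into_space[OF that] by auto
  define t where "t i j k = prob (C i \<inter> A j) / n +
      (if i = j then prob (A i \<inter> B k) - prob (A i) / n else 0)" for i j k
  have t0: "0 \<le> t i j k" if "i < n" "j < n" "k < n" for i j k
  proof (cases "i = j")
    case True
    have "prob (A i - C i) = prob (A i) - prob (C i \<inter> A i)"
      using ev that by (simp add: finite_measure_Diff' Int_commute)
    then have "prob (A i) \<le> prob (C i \<inter> A i) + prob (A i \<inter> B k)"
      using close[OF that(1,3)] by simp
    also have "\<dots> \<le> prob (C i \<inter> A i) + n * prob (A i \<inter> B k)"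
      using n mult_right_mono[of 1 "real n" "prob (A i \<inter> B k)"] by simp
    finally show ?thesis using n True by (simp add: t_def field_simps)
  qed (simp add: t_def)
  have ti: "(\<Sum>i<n. t i j k) = prob (A j \<inter> B k)" if "j < n" "k < n" for j k
  proof -
    have "(\<Sum>i<n. t i j k) = (\<Sum>i<n. prob (C i \<inter> A j)) / n + (prob (A j \<inter> B k) - prob (A j) / n)"
      using that by (simp add: t_def sum.distrib sum_divide_distrib)
    then show ?thesis using sum_prob_event_partition[OF C ev(1)[OF that(1)]] sp ev that by simp
  qed
  have tj: "(\<Sum>j<n. t i j k) = prob (A i \<inter> B k)" if "i < n" "k < n" for i k
  proof -
    have "(\<Sum>j<n. t i j k) = (\<Sum>j<n. prob (A j \<inter> C i)) / n + (prob (A i \<inter> B k) - prob (A i) / n)"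
      using that by (simp add: t_def sum.distrib sum_divide_distrib Int_commute)
    then show ?thesis using sum_prob_event_partition[OF A ev(3)[OF that(1)]] sp ev that CA by simp
  qed
  have tk: "(\<Sum>k<n. t i j k) = prob (C i \<inter> A j)" if "i < n" "j < n" for i j
  proof -
    have "(\<Sum>k<n. t i j k) = prob (C i \<inter> A j) + (if i = j then (\<Sum>k<n. prob (B k \<inter> A i)) - prob (A i) else 0)"
      using n by (simp add: t_def sum.distrib sum_subtractf Int_commute)
    then show ?thesis using sum_prob_event_partition[OF B ev(1)[OF that(1)]] sp ev that
      by (cases "i = j") auto
  qed
  have "\<exists>T. event_partition (A j \<inter> B k) n T \<and> (\<forall>i<n. prob (T i) = t i j k)"
    if "j < n" "k < n" for j k
    using exists_event_partition_prob[OF M, of "A j \<inter> B k" "n - 1" "\<lambda>i. t i j k"] n t0 ti ev that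
    by simp
  then obtain T where T: "\<And>j k. j < n \<Longrightarrow> k < n \<Longrightarrow> event_partition (A j \<inter> B k) n (T j k)"
      "\<And>i j k. i < n \<Longrightarrow> j < n \<Longrightarrow> k < n \<Longrightarrow> prob (T j k i) = t i j k"
    by metis
  have Tev: "T j k i \<in> events" and Tsub: "T j k i \<subseteq> A j" "T j k i \<subseteq> B k"
    if "i < n" "j < n" "k < n" for i j k
    using event_partitionD(1,5)[OF T(1)[OF that(2,3)]] that by blast+
  note uA = event_partitionD(6)[OF A] and uB = event_partitionD(6)[OF B]
  define D where "D i = (\<Union>j<n. \<Union>k<n. T j k i)" for i
  have DB: "D i \<inter> B k = (\<Union>j<n. T j k i)" if "i < n" "k < n" for i k
  proof (intro equalityI subsetI)
    fix x assume "x \<in> D i \<inter> B k"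
    then obtain j k' where x: "j < n" "k' < n" "x \<in> T j k' i" "x \<in> B k" by (auto simp: D_def)
    then have "k' = k" using uB[of k' k x] Tsub(2)[of i j k'] that by auto
    then show "x \<in> (\<Union>j<n. T j k i)" using x by auto
  next
    fix x assume "x \<in> (\<Union>j<n. T j k i)"
    then obtain j where "j < n" "x \<in> T j k i" by auto
    then show "x \<in> D i \<inter> B k" using Tsub(2)[of i j k] that by (auto simp: D_def)
  qed
  have DA: "D i \<inter> A j = (\<Union>k<n. T j k i)" if "i < n" "j < n" for i j
  proof (intro equalityI subsetI)
    fix x assume "x \<in> D i \<inter> A j"
    then obtain j' k where x: "j' < n" "k < n" "x \<in> T j' k i" "x \<in> A j" by (auto simp: D_def)
    then have "j' = j" using uA[of j' j x] Tsub(1)[of i j' k] that by auto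
    then show "x \<in> (\<Union>k<n. T j k i)" using x by auto
  next
    fix x assume "x \<in> (\<Union>k<n. T j k i)"
    then obtain k where "k < n" "x \<in> T j k i" by auto
    then show "x \<in> D i \<inter> A j" using Tsub(1)[of i j k] that by (auto simp: D_def)
  qed
  show ?thesis
  proof (rule that)
    show "event_partition (space M) n D"
      unfolding event_partition_def
    proof (intro conjI allI impI)
      show "D i \<in> events" if "i < n" for i
        unfolding D_def using Tev that by auto
      show "disjoint_family_on D {..<n}"
        unfolding disjoint_family_on_def
      proof (intro ballI impI equals0I)
        fix i i' x assume i: "i \<in> {..<n}" "i' \<in> {..<n}" "i \<noteq> i'" and x: "x \<in> D i \<inter> D i'"
        obtain j k where jk: "j < n" "k < n" "x \<in> T j k i" using x by (auto simp: D_def)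
        obtain j' k' where jk': "j' < n" "k' < n" "x \<in> T j' k' i'" using x by (auto simp: D_def)
        have "j' = j" using uA[of j' j x] jk jk' Tsub(1)[of i j k] Tsub(1)[of i' j' k'] i by auto
        moreover have "k' = k" using uB[of k' k x] jk jk' Tsub(2)[of i j k] Tsub(2)[of i' j' k'] i by auto
        ultimately show False using event_partitionD(6)[OF T(1)[OF jk(1,2)], of i i' x] jk jk' i by auto
      qed
      show "(\<Union>i<n. D i) = space M"
      proof
        show "(\<Union>i<n. D i) \<subseteq> space M" unfolding D_def using Tev sets.sets_into_space by blast
        show "space M \<subseteq> (\<Union>i<n. D i)"
        proof
          fix x assume "x \<in> space M"
          then obtain j k where jk: "j < n" "k < n" "x \<in> A j \<inter> B k"
            using event_partitionD(4)[OF A] event_partitionD(4)[OF B] by blast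
          then show "x \<in> (\<Union>i<n. D i)"
            using event_partitionD(4)[OF T(1)[OF jk(1,2)] jk(3)] unfolding D_def by blast
        qed
      qed
    qed
    show "prob (D i \<inter> B k) = prob (A i \<inter> B k)" if "i < n" "k < n" for i k
    proof -
      have "prob (D i \<inter> B k) = (\<Sum>j<n. prob (T j k i))"
        unfolding DB[OF that]
      proof (rule finite_measure_finite_Union)
        show "disjoint_family_on (\<lambda>j. T j k i) {..<n}"
          unfolding disjoint_family_on_def
        proof (intro ballI impI equals0I)
          fix j j' x assume "j \<in> {..<n}" "j' \<in> {..<n}" "j \<noteq> j'" "x \<in> T j k i \<inter> T j' k i"
          then show False using uA[of j j' x] Tsub(1)[of i j k] Tsub(1)[of i j' k] that by auto
        qed
      qed (use Tev that in auto)
      then show ?thesis using T(2) tj that by simp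
    qed
    show "prob (D i \<inter> A j) = prob (C i \<inter> A j)" if "i < n" "j < n" for i j
    proof -
      have "prob (D i \<inter> A j) = (\<Sum>k<n. prob (T j k i))"
        unfolding DA[OF that]
      proof (rule finite_measure_finite_Union)
        show "disjoint_family_on (\<lambda>k. T j k i) {..<n}"
          unfolding disjoint_family_on_def
        proof (intro ballI impI equals0I)
          fix k k' x assume "k \<in> {..<n}" "k' \<in> {..<n}" "k \<noteq> k'" "x \<in> T j k i \<inter> T j k' i"
          then show False using uB[of k k' x] Tsub(2)[of i j k] Tsub(2)[of i j k'] that by auto
        qed
      qed (use Tev that in auto)
      then show ?thesis using T(2) tk that by simp
    qed
  qed
qed

section \<open>Quantifier-free types of partitions\<close>

lemma malg_sdiff_in_malg: "a \<in> malg M \<Longrightarrow> b \<in> malg M \<Longrightarrow> malg_sdiff M a b \<in> malg M"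
  unfolding malg_sdiff_def using malg_rep(1) by (intro malg_class_in_malg) auto

lemma malg_empty_in_malg: "malg_empty M \<in> malg M"
  unfolding malg_empty_def by (intro malg_class_in_malg) auto

lemma malg_AutD:
  assumes "w \<in> malg_Aut M" "a \<in> malg M"
  shows "w a \<in> malg M"
    and "b \<in> malg M \<Longrightarrow> malg_dist M (w a) (w b) = malg_dist M a b"
    and "b \<in> malg M \<Longrightarrow> w (malg_sdiff M a b) = malg_sdiff M (w a) (w b)"
    and "b \<in> malg M \<Longrightarrow> w a = w b \<longleftrightarrow> a = b"
    and "w (malg_empty M) = malg_empty M"
  using assms bij_betwE[of w "malg M" "malg M"]
  by (auto simp: malg_Aut_def bij_betw_def inj_on_def)

text \<open>Terms, and then formulas, are invariant under automorphisms that fix the parameters.\<close>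

lemma malg_Aut_term_val:
  assumes w: "w \<in> malg_Aut M"
    and "\<And>i. i \<in> term_vars t \<Longrightarrow> x i \<in> malg M \<and> w (x i) = y i"
    and "\<And>c. c \<in> set_malg_term t \<Longrightarrow> c \<in> malg M \<and> w c = c"
  shows "malg_term_val M x t \<in> malg M \<and> w (malg_term_val M x t) = malg_term_val M y t"
  using assms(2-)
proof (induction t)
  case (SDiff s t)
  then show ?case using malg_sdiff_in_malg malg_AutD(3)[OF w] by simp
qed (use malg_empty_in_malg malg_AutD(5)[OF w malg_empty_in_malg] in auto)

lemma malg_Aut_real_term_val:
  assumes w: "w \<in> malg_Aut M"
    and "\<And>i. i \<in> real_term_vars t \<Longrightarrow> x i \<in> malg M \<and> w (x i) = y i"
    and "\<And>c. c \<in> set_real_term t \<Longrightarrow> c \<in> malg M \<and> w c = c"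
  shows "real_term_val M x t = real_term_val M y t"
proof (cases t)
  case (Rho s u)
  then show ?thesis
    using malg_Aut_term_val[OF w, of s x y] malg_Aut_term_val[OF w, of u x y] assms(2,3)
      malg_AutD(2)[OF w, of "malg_term_val M x s" "malg_term_val M x u"] by simp
qed simp

lemma malg_Aut_qf_sat:
  assumes w: "w \<in> malg_Aut M"
    and "\<And>i. i \<in> qf_vars \<phi> \<Longrightarrow> x i \<in> malg M \<and> w (x i) = y i"
    and "\<And>c. c \<in> set_qf_formula \<phi> \<Longrightarrow> c \<in> malg M \<and> w c = c"
  shows "qf_sat M x \<phi> \<longleftrightarrow> qf_sat M y \<phi>"
  using assms(2-)
proof (induction \<phi>)
  case (EqM s t)
  then show ?case
    using malg_Aut_term_val[OF w, of s x y] malg_Aut_term_val[OF w, of t x y]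
      malg_AutD(4)[OF w, of "malg_term_val M x s" "malg_term_val M x t"] by simp
next
  case (EqR s t)
  then show ?case
    using malg_Aut_real_term_val[OF w, of s x y] malg_Aut_real_term_val[OF w, of t x y] by simp
qed auto

lemma malg_Aut_realizations:
  assumes w: "w \<in> malg_Aut M" and p: "p \<subseteq> qf_formulas n B"
    and B: "\<And>c. c \<in> B \<Longrightarrow> c \<in> malg M \<and> w c = c"
    and x: "x \<in> malg_tuples M n"
  shows "(\<lambda>i\<in>{..<n}. w (x i)) \<in> realizations M n p \<longleftrightarrow> x \<in> realizations M n p"
proof -
  have xm: "x i \<in> malg M" if "i < n" for i using x that by (auto simp: malg_tuples_def)
  have "qf_sat M x \<phi> \<longleftrightarrow> qf_sat M (\<lambda>i\<in>{..<n}. w (x i)) \<phi>" if "\<phi> \<in> p" for \<phi>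
    using p that B xm by (intro malg_Aut_qf_sat[OF w]) (auto simp: qf_formulas_def subset_iff)
  moreover have "(\<lambda>i\<in>{..<n}. w (x i)) \<in> malg_tuples M n"
    using malg_AutD(1)[OF w] xm by (auto simp: malg_tuples_def)
  ultimately show ?thesis using x by (auto simp: realizations_def)
qed

definition partition_classes :: "nat \<Rightarrow> (nat \<Rightarrow> 'a set) \<Rightarrow> nat \<Rightarrow> 'a set set" where
  "partition_classes n A = (\<lambda>i\<in>{..<n}. malg_class M (A i))"

lemma partition_classes_in_tuples:
  "event_partition S n A \<Longrightarrow> partition_classes n A \<in> malg_tuples M n"
  by (auto simp: partition_classes_def malg_tuples_def event_partition_def malg_class_in_malg)

text \<open>By homogeneity \<open>B\<close> is the image of \<open>A\<close> under an automorphism, hence has the same type.\<close>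

lemma partition_realizes_qftp:
  assumes M: "standard_probability_space M"
    and A: "event_partition (space M) n A" and B: "event_partition (space M) n B"
    and BA: "\<And>i. i < n \<Longrightarrow> prob (B i) = prob (A i)"
  shows "partition_classes n B \<in> realizations M n (qftp M n (partition_classes n A))"
proof -
  have "prob (A i \<inter> A k) = prob (B i \<inter> B k)" if "i < n" "k < n" for i k
  proof (cases "i = k")
    case False
    then have "A i \<inter> A k = {}" "B i \<inter> B k = {}"
      using disjoint_family_onD event_partitionD(2)[OF A] event_partitionD(2)[OF B] that
      by (metis lessThan_iff)+
    then show ?thesis by simp
  qed (use BA that in simp)
  then obtain w where w: "w \<in> malg_Aut M"
      "\<And>i. i < n \<Longrightarrow> w (malg_class M (A i)) = malg_class M (B i)"
    using automorphism_of_partition_pairs[OF M A A B B] by metis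
  have eq: "partition_classes n B = (\<lambda>i\<in>{..<n}. w (partition_classes n A i))"
    unfolding partition_classes_def using w(2) by (intro restrict_ext) simp
  have "partition_classes n A \<in> realizations M n (qftp M n (partition_classes n A))"
    using partition_classes_in_tuples[OF A] by (simp add: realizations_def qftp_def)
  then show ?thesis
    unfolding eq using partition_classes_in_tuples[OF A]
    by (subst malg_Aut_realizations[OF w(1), of _ n "{}"]) (auto simp: qftp_def)
qed

lemma prob_sym_diff:
  assumes "S \<in> events" "T \<in> events"
  shows "prob (sym_diff S T) = prob S + prob T - 2 * prob (S \<inter> T)"
proof -
  have "prob (sym_diff S T) = prob (S - T) + prob (T - S)"
    using assms by (intro finite_measure_Union) auto
  then show ?thesis using assms by (simp add: finite_measure_Diff' Int_commute)
qed

text \<open>Removing the overlaps and giving the uncovered rest of the space to the piece with index 0 changes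
  the sets only by null sets.\<close>

lemma exact_partition_of_almost_partition:
  assumes n: "0 < n" and R: "\<And>i. i < n \<Longrightarrow> R i \<in> events"
    and overlap: "\<And>i j. i < n \<Longrightarrow> j < n \<Longrightarrow> i \<noteq> j \<Longrightarrow> prob (R i \<inter> R j) = 0"
    and total: "(\<Sum>i<n. prob (R i)) = 1"
  shows "\<exists>B. event_partition (space M) n B \<and> (\<forall>i<n. malg_class M (B i) = malg_class M (R i))"
proof -
  have "AE x in M. i < n \<longrightarrow> j < n \<longrightarrow> i \<noteq> j \<longrightarrow> \<not> (x \<in> R i \<and> x \<in> R j)" for i j
  proof (cases "i < n \<and> j < n \<and> i \<noteq> j")
    case True
    then have "AE x in M. x \<notin> R i \<inter> R j" using overlap R by (subst prob_eq_0[symmetric]) auto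
    then show ?thesis by eventually_elim auto
  qed auto
  then have dis: "AE x in M. \<forall>i j. i < n \<longrightarrow> j < n \<longrightarrow> i \<noteq> j \<longrightarrow> \<not> (x \<in> R i \<and> x \<in> R j)"
    by (simp add: AE_all_countable)
  define D where "D i = R i - (\<Union>j<i. R j)" for i
  have Dev: "D i \<in> events" if "i < n" for i using R that by (auto simp: D_def)
  have DR: "AE x in M. x \<in> D i \<longleftrightarrow> x \<in> R i" if "i < n" for i
    using dis
  proof eventually_elim
    case (elim x)
    then show ?case using that unfolding D_def by (auto dest: order.strict_trans)
  qed
  have Ddis: "i = j" if "x \<in> D i" "x \<in> D j" for i j x
    using that by (cases i j rule: linorder_cases) (auto simp: D_def)
  have "prob (\<Union>i<n. D i) = (\<Sum>i<n. prob (D i))"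
    using Dev Ddis by (intro finite_measure_finite_Union) (auto simp: disjoint_family_on_def)
  also have "\<dots> = (\<Sum>i<n. prob (R i))"
    using DR Dev R by (intro sum.cong finite_measure_eq_AE) auto
  finally have "AE x in M. x \<in> (\<Union>i<n. D i)"
    using total by (intro AE_prob_1) simp
  then have full: "AE x in M. \<exists>i<n. x \<in> D i" by eventually_elim auto
  define B where "B i = D i \<union> (if i = 0 then space M - (\<Union>j<n. D j) else {})" for i
  have Bev: "B i \<in> events" if "i < n" for i using Dev that unfolding B_def by auto
  have "event_partition (space M) n B"
    unfolding event_partition_def
  proof (intro conjI allI impI Bev)
    show "disjoint_family_on B {..<n}"
      unfolding disjoint_family_on_def B_def using Ddis by (auto split: if_splits)
    have "space M \<subseteq> B 0 \<union> (\<Union>i<n. B i)" by (auto simp: B_def)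
    also have "\<dots> = (\<Union>i<n. B i)" using n by auto
    finally have "space M \<subseteq> (\<Union>i<n. B i)" .
    moreover have "(\<Union>i<n. B i) \<subseteq> space M" using Bev sets.sets_into_space by blast
    ultimately show "(\<Union>i<n. B i) = space M" by auto
  qed
  moreover have "malg_class M (B i) = malg_class M (R i)" if "i < n" for i
  proof -
    have "AE x in M. x \<in> B i \<longleftrightarrow> x \<in> R i"
      using DR[OF that] full by eventually_elim (auto simp: B_def)
    then show ?thesis using Bev R that by (simp add: malg_class_eq_iff_AE)
  qed
  ultimately show ?thesis by blast
qed

text \<open>The formulas \<open>\<rho>(x\<^sub>i, \<emptyset>) = prob (A i)\<close> fix the measures of the entries, and
  \<open>\<rho>(x\<^sub>i, x\<^sub>j) = prob (A i) + prob (A j)\<close> says that distinct entries are disjoint. That the entries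
  cover the space follows because their measures add up to 1.\<close>

lemma qftp_realization_is_partition:
  assumes A: "event_partition (space M) n A"
    and b: "b \<in> realizations M n (qftp M n (partition_classes n A))"
  obtains B where "event_partition (space M) n B" "b = partition_classes n B"
    "\<And>i. i < n \<Longrightarrow> prob (B i) = prob (A i)"
proof -
  define R where "R i = malg_rep (b i)" for i
  have bm: "b i \<in> malg M" if "i < n" for i
    using b that by (auto simp: realizations_def malg_tuples_def)
  have R: "R i \<in> events" "b i = malg_class M (R i)" if "i < n" for i
    using malg_rep[OF bm[OF that]] by (auto simp: R_def)
  have sat: "qf_sat M b \<phi>" if "\<phi> \<in> qf_formulas n {}" "qf_sat M (partition_classes n A) \<phi>" for \<phi>
    using b that by (auto simp: realizations_def qftp_def)
  note Aev = event_partitionD(1)[OF A]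
  have m: "prob (R i) = prob (A i)" if "i < n" for i
    using sat[of "EqR (Rho (Var i) Empt) (RConst (prob (A i)))"] that R[OF that] Aev[OF that]
    by (simp add: qf_formulas_def partition_classes_def malg_empty_def malg_dist_class)
  have overlap: "prob (R i \<inter> R j) = 0" if ij: "i < n" "j < n" "i \<noteq> j" for i j
  proof -
    have "A i \<inter> A j = {}" using disjoint_family_onD[OF event_partitionD(2)[OF A], of i j] ij by auto
    then have "prob (sym_diff (A i) (A j)) = prob (A i) + prob (A j)"
      using Aev ij by (simp add: prob_sym_diff)
    then have "prob (sym_diff (R i) (R j)) = prob (A i) + prob (A j)"
      using sat[of "EqR (Rho (Var i) (Var j)) (RConst (prob (A i) + prob (A j)))"] ij R Aev
      by (simp add: qf_formulas_def partition_classes_def malg_dist_class)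
    then show ?thesis using prob_sym_diff[of "R i" "R j"] R ij m by simp
  qed
  have n: "0 < n" using event_partitionD(3)[OF A] not_empty by (cases n) auto
  have "(\<Sum>i<n. prob (R i)) = (\<Sum>i<n. prob (A i))" using m by simp
  also have "\<dots> = prob (\<Union>i<n. A i)"
    using event_partitionD(1,2)[OF A]
    by (intro finite_measure_finite_Union[symmetric]) auto
  also have "\<dots> = 1" using event_partitionD(3)[OF A] prob_space by simp
  finally obtain B where B: "event_partition (space M) n B"
      "\<And>i. i < n \<Longrightarrow> malg_class M (B i) = malg_class M (R i)"
    using exact_partition_of_almost_partition[of n R, OF n R(1) overlap] by blast
  have "b = partition_classes n B"
  proof
    fix i show "b i = partition_classes n B i"
      using b R B(2) by (cases "i < n") (auto simp: partition_classes_def realizations_def malg_tuples_def PiE_def extensional_def)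
  qed
  moreover have "prob (B i) = prob (A i)" if "i < n" for i
  proof -
    have "prob (B i) = prob (R i)"
      using B(2)[OF that] R(1)[OF that] event_partitionD(1)[OF B(1) that]
      by (intro finite_measure_eq_AE) (auto simp: malg_class_eq_iff_AE)
    then show ?thesis using m that by simp
  qed
  ultimately show ?thesis using B(1) that by blast
qed

section \<open>Orbits near a generic partition\<close>

text \<open>Given a realization \<open>C\<close> of the type, amalgamation yields \<open>D\<close>. The automorphism \<open>w\<close> fixes \<open>B\<close> and
  takes \<open>A\<close> to \<open>D\<close>, which puts \<open>D\<close> in the orbit; the automorphism \<open>v\<close> fixes \<open>A\<close> and takes \<open>C\<close> to \<open>D\<close>,
  so \<open>D\<close> realizes every formula over \<open>A\<close> that \<open>C\<close> does.\<close>

lemma relatively_saturated_of_overlaps: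
  assumes M: "standard_probability_space M"
    and A: "event_partition (space M) n A" and B: "event_partition (space M) n B"
    and BA: "\<And>i. i < n \<Longrightarrow> prob (B i) = prob (A i)"
    and \<delta>: "\<And>i k. i < n \<Longrightarrow> k < n \<Longrightarrow> \<delta> \<le> prob (A i \<inter> B k)"
  shows "relatively_saturated M n \<delta> (partition_classes n A)
    (tuple_orbit (stabilizer M n (partition_classes n B)) n (partition_classes n A))"
    (is "relatively_saturated M n \<delta> ?a ?Y")
proof -
  let ?c = "malg_class M"
  have am: "?a i = ?c (A i)" "?a i \<in> malg M" if "i < n" for i
    using that event_partitionD(1)[OF A] by (auto simp: partition_classes_def malg_class_in_malg)
  have "y \<in> realizations M n (qftp M n ?a)" if y: "y \<in> ?Y" for y
  proof -
    obtain w where w: "w \<in> malg_Aut M" "y = (\<lambda>i\<in>{..<n}. w (?a i))"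
      using y by (auto simp: tuple_orbit_def stabilizer_def)
    then show ?thesis
      using partition_classes_in_tuples[OF A] malg_Aut_realizations[OF w(1), of "qftp M n ?a" n "{}" ?a]
      by (auto simp: qftp_def realizations_def)
  qed
  moreover have "realizations M n p \<inter> ?Y \<noteq> {}"
    if p: "eps_qf_type M n \<delta> ?a p" and "realizations M n p \<noteq> {}" for p
  proof -
    obtain c where c: "c \<in> realizations M n p" using \<open>realizations M n p \<noteq> {}\<close> by blast
    then have "c \<in> realizations M n (qftp M n ?a)"
      using p by (auto simp: realizations_def eps_qf_type_def)
    then obtain C where C: "event_partition (space M) n C" "c = partition_classes n C"
        "\<And>i. i < n \<Longrightarrow> prob (C i) = prob (A i)"
      using qftp_realization_is_partition[OF A] by blast
    have close: "prob (A i - C i) \<le> prob (A i \<inter> B k)" if "i < n" "k < n" for i k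
    proof -
      note ev = event_partitionD(1)[OF A that(1)] event_partitionD(1)[OF C(1) that(1)]
      obtain d where d: "d < \<delta>" "EqR (Rho (Par (?a i)) (Var i)) (RConst d) \<in> p"
        using p \<open>i < n\<close> unfolding eps_qf_type_def by blast
      then have "malg_dist M (?a i) (c i) = d" using c by (auto simp: realizations_def)
      then have "prob (sym_diff (A i) (C i)) = d"
        using that ev by (simp add: C(2) partition_classes_def malg_dist_class)
      moreover have "prob (A i - C i) \<le> prob (sym_diff (A i) (C i))"
        using ev by (intro finite_measure_mono) auto
      ultimately show ?thesis using d(1) \<delta>[OF that] by simp
    qed
    obtain D where D: "event_partition (space M) n D"
        "\<And>i k. i < n \<Longrightarrow> k < n \<Longrightarrow> prob (D i \<inter> B k) = prob (A i \<inter> B k)"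
        "\<And>i j. i < n \<Longrightarrow> j < n \<Longrightarrow> prob (D i \<inter> A j) = prob (C i \<inter> A j)"
      using amalgamate_partitions[OF M A B C(1) C(3) BA close] by blast
    obtain w where w: "w \<in> malg_Aut M" "\<And>i. i < n \<Longrightarrow> w (?c (A i)) = ?c (D i)"
        "\<And>i. i < n \<Longrightarrow> w (?c (B i)) = ?c (B i)"
      using automorphism_of_partition_pairs[OF M A B D(1) B] D(2) by metis
    obtain v where v: "v \<in> malg_Aut M" "\<And>i. i < n \<Longrightarrow> v (?c (C i)) = ?c (D i)"
        "\<And>i. i < n \<Longrightarrow> v (?c (A i)) = ?c (A i)"
      using automorphism_of_partition_pairs[OF M C(1) A D(1) A] D(3) by metis
    have Dv: "(\<lambda>i\<in>{..<n}. v (c i)) = partition_classes n D"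
      unfolding partition_classes_def C(2) using v(2) by (intro restrict_ext) simp
    have Dw: "(\<lambda>i\<in>{..<n}. w (?a i)) = partition_classes n D"
      unfolding partition_classes_def using w(2) by (intro restrict_ext) simp
    have "partition_classes n D \<in> realizations M n p"
      unfolding Dv[symmetric]
    proof (subst malg_Aut_realizations[OF v(1)])
      show "p \<subseteq> qf_formulas n (?a ` {..<n})" using p by (simp add: eps_qf_type_def qf_type_def)
      show "x \<in> malg M \<and> v x = x" if "x \<in> ?a ` {..<n}" for x
        using that am v(3) by auto
      show "c \<in> malg_tuples M n" using c by (simp add: realizations_def)
    qed (rule c)
    moreover have "w \<in> stabilizer M n (partition_classes n B)"
      using w by (simp add: stabilizer_def partition_classes_def)
    then have "partition_classes n D \<in> ?Y"
      unfolding tuple_orbit_def Dw[symmetric] by blast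
    ultimately show ?thesis by blast
  qed
  ultimately show ?thesis unfolding relatively_saturated_def by blast
qed

section \<open>Generic partitions meet every piece\<close>

text \<open>Some other piece \<open>B l\<close> meets \<open>A\<close> in positive measure. Exchanging a small part of \<open>A \<inter> B l\<close> with a
  part of \<open>B k\<close> of the same measure keeps all measures and makes \<open>B k\<close> meet \<open>A\<close>.\<close>

lemma swap_to_meet:
  assumes M: "standard_probability_space M"
    and A: "A \<in> events" "0 < prob A"
    and B: "event_partition (space M) n B" and k: "k < n" "0 < prob (B k)" "prob (A \<inter> B k) = 0"
    and \<epsilon>: "0 < \<epsilon>"
  shows "\<exists>C. event_partition (space M) n C \<and> (\<forall>j<n. prob (C j) = prob (B j)) \<and>
    0 < prob (A \<inter> C k) \<and> (\<forall>j<n. prob (sym_diff (C j) (B j)) \<le> \<epsilon>)"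
proof -
  note ev = event_partitionD(1)[OF B]
  have "\<exists>l<n. 0 < prob (A \<inter> B l)"
  proof (rule ccontr)
    assume "\<not> (\<exists>l<n. 0 < prob (A \<inter> B l))"
    then have "prob (B l \<inter> A) = 0" if "l < n" for l
      using that by (auto simp: zero_less_measure_iff Int_commute)
    then have "prob (space M \<inter> A) = 0" using sum_prob_event_partition[OF B A(1)] by simp
    then show False using A sets.sets_into_space[OF A(1)] by (simp add: Int_absorb1)
  qed
  then obtain l where l: "l < n" "0 < prob (A \<inter> B l)" by blast
  have kl: "k \<noteq> l" using k l by auto
  define s where "s = min (\<epsilon> / 2) (min (prob (A \<inter> B l)) (prob (B k)))"
  have s: "0 < s" "s \<le> \<epsilon> / 2" "s \<le> prob (A \<inter> B l)" "s \<le> prob (B k)"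
    using \<epsilon> l k by (auto simp: s_def)
  obtain S where S: "S \<in> events" "S \<subseteq> A \<inter> B l" "prob S = s"
    using exists_subevent_prob[OF M, of "A \<inter> B l" s] ev[OF l(1)] A s by auto
  obtain S' where S': "S' \<in> events" "S' \<subseteq> B k" "prob S' = s"
    using exists_subevent_prob[OF M, of "B k" s] ev[OF k(1)] s by auto
  define C where "C = B(k := (B k - S') \<union> S, l := (B l - S) \<union> S')"
  have Ck: "C k = (B k - S') \<union> S" and Cl: "C l = (B l - S) \<union> S'"
    and Cj: "\<And>j. j \<noteq> k \<Longrightarrow> j \<noteq> l \<Longrightarrow> C j = B j"
    using kl by (auto simp: C_def)
  have BB: "B k \<inter> B l = {}" using disjoint_family_onD[OF event_partitionD(2)[OF B]] k l kl by auto
  have Cev: "C j \<in> events" if "j < n" for j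
    using ev that k l S S' by (auto simp: C_def)
  let ?\<tau> = "Transposition.transpose k l"
  \<comment> \<open>On the exchanged set the new partition is the old one with \<open>k\<close> and \<open>l\<close> interchanged.\<close>
  have swap: "x \<in> C j \<longleftrightarrow> x \<in> B (if x \<in> S \<union> S' then ?\<tau> j else j)"
    if "j < n" for x j
  proof -
    have "x \<in> S \<Longrightarrow> x \<in> B i \<longleftrightarrow> i = l" "x \<in> S' \<Longrightarrow> x \<in> B i \<longleftrightarrow> i = k" if "i < n" for i
      using event_partitionD(6)[OF B that, of l x] event_partitionD(6)[OF B that, of k x] S S' k l by auto
    then show ?thesis
      using S(2) S'(2) BB kl that k l by (cases "j = k"; cases "j = l") (auto simp: Ck Cl Cj)
  qed
  have "event_partition (space M) n C"
    unfolding event_partition_def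
  proof (intro conjI allI impI Cev)
    have tr: "?\<tau> j < n" if "j < n" for j using that k l by (auto simp: Transposition.transpose_def)
    show "disjoint_family_on C {..<n}"
      unfolding disjoint_family_on_def
    proof (intro ballI impI equals0I)
      fix i j x assume ij: "i \<in> {..<n}" "j \<in> {..<n}" "i \<noteq> j" and x: "x \<in> C i \<inter> C j"
      then have "?\<tau> i \<noteq> ?\<tau> j" by (auto simp: Transposition.transpose_def)
      then show False
        using x ij swap[of i x] swap[of j x] tr event_partitionD(6)[OF B, of i j x]
          event_partitionD(6)[OF B, of "?\<tau> i" "?\<tau> j" x]
        by (auto split: if_splits)
    qed
    show "(\<Union>i<n. C i) = space M"
    proof
      show "(\<Union>i<n. C i) \<subseteq> space M" using Cev sets.sets_into_space by blast
      show "space M \<subseteq> (\<Union>i<n. C i)"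
      proof
        fix x assume "x \<in> space M"
        then obtain j where j: "j < n" "x \<in> B j" using event_partitionD(4)[OF B] by auto
        show "x \<in> (\<Union>i<n. C i)"
          using swap[of j x] swap[of "?\<tau> j" x] tr j by (auto split: if_splits)
      qed
    qed
  qed
  moreover have "prob (C j) = prob (B j)" if "j < n" for j
  proof -
    have "prob ((B k - S') \<union> S) = prob (B k - S') + prob S"
      using ev k S S' BB by (intro finite_measure_Union) auto
    moreover have "prob ((B l - S) \<union> S') = prob (B l - S) + prob S'"
      using ev l S S' BB by (intro finite_measure_Union) auto
    moreover have "prob (B k - S') = prob (B k) - s" "prob (B l - S) = prob (B l) - s"
      using ev k l S S' by (auto simp: finite_measure_Diff)
    ultimately show ?thesis
      using S(3) S'(3) by (cases "j = k"; cases "j = l") (simp_all add: Ck Cl Cj)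
  qed
  moreover have "0 < prob (A \<inter> C k)"
  proof -
    have "S \<subseteq> A \<inter> C k" using S by (auto simp: Ck)
    then have "prob S \<le> prob (A \<inter> C k)" using A Cev k by (intro finite_measure_mono) auto
    then show ?thesis using S s by simp
  qed
  moreover have "prob (sym_diff (C j) (B j)) \<le> \<epsilon>" if "j < n" for j
  proof -
    have "sym_diff (C j) (B j) \<subseteq> S \<union> S'"
      by (cases "j = k"; cases "j = l") (auto simp: Ck Cl Cj)
    then have "prob (sym_diff (C j) (B j)) \<le> prob (S \<union> S')"
      using S S' by (intro finite_measure_mono) auto
    also have "\<dots> \<le> prob S + prob S'" using S S' by (intro measure_Un_le) auto
    finally show ?thesis using S S' s by simp
  qed
  ultimately show ?thesis by blast
qed

lemma continuous_map_malg_dist: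
  assumes c: "c \<in> malg M" and k: "k < n"
  shows "continuous_map (malg_power_topology M n) euclideanreal (\<lambda>b. malg_dist M c (b k))"
proof -
  interpret MS: Metric_space "malg M" "malg_dist M" by (rule Metric_space_malg)
  let ?m = "metric (malg M, malg_dist M)"
  have "continuous_map (malg_power_topology M n) (mtopology_of ?m) (\<lambda>b. b k)"
    unfolding malg_power_topology_def MS.mtopology_of
    using k by (intro continuous_map_product_projection) auto
  moreover have "continuous_map (malg_power_topology M n) (mtopology_of ?m) (\<lambda>b. c)"
    using c by (simp add: MS.mtopology_of)
  ultimately show ?thesis
    using continuous_map_mdist[of "malg_power_topology M n" ?m "\<lambda>b. c" "\<lambda>b. b k"]
    by (simp add: MS.mdist_metric)
qed

text \<open>On realizations of the type, the distance \<open>prob (A i) + prob (A k)\<close> is the largest possible one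
  and means that the \<open>k\<close>-th entry is disjoint from \<open>A i\<close>. It is a closed condition, and
  every realization satisfying it is a limit of realizations, obtained by swapping, that do not.\<close>

lemma nowhere_dense_missing_piece:
  assumes M: "standard_probability_space M"
    and A: "event_partition (space M) n A" and pos: "\<And>i. i < n \<Longrightarrow> 0 < prob (A i)"
    and i: "i < n" and k: "k < n"
  defines "R \<equiv> realizations M n (qftp M n (partition_classes n A))"
  shows "nowhere_dense_in (subtopology (malg_power_topology M n) R)
    {b \<in> R. malg_dist M (malg_class M (A i)) (b k) = prob (A i) + prob (A k)}"
    (is "nowhere_dense_in ?T ?N")
proof -
  interpret MS: Metric_space "malg M" "malg_dist M" by (rule Metric_space_malg)
  have "topspace (malg_power_topology M n) = malg_tuples M n"
    by (simp add: malg_power_topology_def malg_tuples_def)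
  then have top: "topspace ?T = R"
    by (auto simp: R_def realizations_def)
  note Aev = event_partitionD(1)[OF A]
  have "continuous_map ?T euclideanreal (\<lambda>b. malg_dist M (malg_class M (A i)) (b k))"
    using Aev i k by (intro continuous_map_from_subtopology continuous_map_malg_dist malg_class_in_malg)
  from closedin_continuous_map_preimage[OF this, of "{prob (A i) + prob (A k)}"]
  have "closedin ?T ?N" by (simp add: top del: topspace_subtopology)
  then have cl: "?T closure_of ?N = ?N" by (rule closure_of_closedin)
  have "b \<notin> ?T interior_of ?N" for b
  proof
    assume b: "b \<in> ?T interior_of ?N"
    then have bN: "b \<in> ?N" by (rule subsetD[OF interior_of_subset])
    then have "b \<in> R" by simp
    then obtain B where B: "event_partition (space M) n B" "b = partition_classes n B"
        "\<And>i. i < n \<Longrightarrow> prob (B i) = prob (A i)"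
      using qftp_realization_is_partition[OF A] unfolding R_def by blast
    have overlap: "malg_dist M (malg_class M (A i)) (partition_classes n C k) = prob (A i) + prob (A k) \<longleftrightarrow>
        prob (A i \<inter> C k) = 0"
      if "event_partition (space M) n C" "prob (C k) = prob (A k)" for C
      using Aev[OF i] event_partitionD(1)[OF that(1) k] that(2) k
      by (simp add: partition_classes_def malg_dist_class prob_sym_diff)
    have "prob (A i \<inter> B k) = 0" using bN overlap[OF B(1)] B k by simp
    then have "\<exists>C. event_partition (space M) n C \<and> (\<forall>j<n. prob (C j) = prob (B j)) \<and>
        0 < prob (A i \<inter> C k) \<and> (\<forall>j<n. prob (sym_diff (C j) (B j)) \<le> 1 / Suc m)" for m
      using swap_to_meet[OF M Aev[OF i] pos[OF i] B(1) k, of "1 / Suc m"] pos[OF k] B(3)[OF k] by simp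
    then obtain C where C: "\<And>m. event_partition (space M) n (C m)"
        "\<And>m j. j < n \<Longrightarrow> prob (C m j) = prob (B j)" "\<And>m. 0 < prob (A i \<inter> C m k)"
        "\<And>m j. j < n \<Longrightarrow> prob (sym_diff (C m j) (B j)) \<le> 1 / Suc m"
      by metis
    have CR: "partition_classes n (C m) \<in> R" for m
      unfolding R_def using C(2) B(3) by (intro partition_realizes_qftp M A C(1)) simp
    have "limitin (malg_power_topology M n) (\<lambda>m. partition_classes n (C m)) b sequentially"
      unfolding malg_power_topology_def limitin_componentwise
    proof (intro conjI ballI)
      show "b \<in> extensional {..<n}" by (simp add: B(2) partition_classes_def)
      show "\<forall>\<^sub>F m in sequentially. partition_classes n (C m) \<in>
          topspace (product_topology (\<lambda>_. MS.mtopology) {..<n})"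
        using partition_classes_in_tuples[OF C(1)] by (simp add: malg_tuples_def)
      fix j assume "j \<in> {..<n}"
      then have j: "j < n" by simp
      note evs = event_partitionD(1)[OF C(1) j] event_partitionD(1)[OF B(1) j]
      show "limitin MS.mtopology (\<lambda>m. partition_classes n (C m) j) (b j) sequentially"
        unfolding MS.limitin_metric_dist_null
      proof (intro conjI)
        have "(\<lambda>m. 1 / real (Suc m)) \<longlonglongrightarrow> 0" by (rule LIMSEQ_Suc[OF lim_1_over_n])
        then show "(\<lambda>m. malg_dist M (partition_classes n (C m) j) (b j)) \<longlonglongrightarrow> 0"
        proof (rule real_tendsto_sandwich[OF _ _ tendsto_const, rotated 2])
          show "\<forall>\<^sub>F m in sequentially. malg_dist M (partition_classes n (C m) j) (b j) \<le> 1 / real (Suc m)"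
            using C(4)[OF j] evs j by (simp add: B(2) partition_classes_def malg_dist_class)
        qed simp
      qed (use j evs in \<open>simp_all add: B(2) partition_classes_def malg_class_in_malg\<close>)
    qed
    then have "limitin ?T (\<lambda>m. partition_classes n (C m)) b sequentially"
      using CR bN by (simp add: limitin_subtopology)
    then have "\<forall>\<^sub>F m in sequentially. partition_classes n (C m) \<in> ?T interior_of ?N"
      using b by (auto simp: limitin_def)
    then obtain m where "partition_classes n (C m) \<in> ?T interior_of ?N"
      by (auto simp: eventually_sequentially)
    then have "partition_classes n (C m) \<in> ?N" by (rule subsetD[OF interior_of_subset])
    then have "prob (A i \<inter> C m k) = 0" using overlap[OF C(1)] C(2) B(3) k by simp
    then show False using C(3)[of m] by simp
  qed
  then show ?thesis unfolding nowhere_dense_in_def cl top by auto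
qed

lemma partition_is_ample:
  assumes M: "standard_probability_space M"
    and A: "event_partition (space M) n A" and pos: "\<And>i. i < n \<Longrightarrow> 0 < prob (A i)"
  shows "ample M n (partition_classes n A)"
proof -
  let ?a = "partition_classes n A"
  define R where "R = realizations M n (qftp M n ?a)"
  define G where "G = {b \<in> R. \<exists>\<delta>>0. relatively_saturated M n \<delta> ?a (tuple_orbit (stabilizer M n b) n ?a)}"
  let ?T = "subtopology (malg_power_topology M n) R"
  define E where "E i k = {b \<in> R. malg_dist M (malg_class M (A i)) (b k) = prob (A i) + prob (A k)}" for i k
  define N where "N m = (case prod_decode m of (i, k) \<Rightarrow> if i < n \<and> k < n then E i k else {})" for m
  have "topspace (malg_power_topology M n) = malg_tuples M n"
    using Metric_space.topspace_mtopology[OF Metric_space_malg]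
    by (simp add: malg_power_topology_def malg_tuples_def)
  then have top: "topspace ?T = R"
    by (auto simp: R_def realizations_def)
  have "nowhere_dense_in ?T (N m)" for m
  proof -
    have "nowhere_dense_in ?T (E i k)" if "i < n" "k < n" for i k
      unfolding E_def R_def by (rule nowhere_dense_missing_piece[OF M A pos that])
    then show ?thesis
      by (auto simp: N_def nowhere_dense_in_def split: prod.split)
  qed
  moreover have "R - G \<subseteq> (\<Union>m. N m)"
  proof
    fix b assume b: "b \<in> R - G"
    then obtain B where B: "event_partition (space M) n B" "b = partition_classes n B"
        "\<And>i. i < n \<Longrightarrow> prob (B i) = prob (A i)"
      using qftp_realization_is_partition[OF A] unfolding R_def by blast
    note ev = event_partitionD(1)[OF A] event_partitionD(1)[OF B(1)]
    have n: "0 < n" using event_partitionD(3)[OF A] not_empty by (cases n) auto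
    define \<delta> where "\<delta> = Min ((\<lambda>(i, k). prob (A i \<inter> B k)) ` ({..<n} \<times> {..<n}))"
    have le: "\<delta> \<le> prob (A i \<inter> B k)" if "i < n" "k < n" for i k
      unfolding \<delta>_def using that by (intro Min_le) auto
    have "\<not> 0 < \<delta>"
      using relatively_saturated_of_overlaps[OF M A B(1) B(3) le] b by (auto simp: G_def B(2))
    moreover have "\<delta> \<in> (\<lambda>(i, k). prob (A i \<inter> B k)) ` ({..<n} \<times> {..<n})"
      unfolding \<delta>_def using n by (intro Min_in) auto
    ultimately obtain i k where ik: "i < n" "k < n" "prob (A i \<inter> B k) = 0"
      by (auto simp: zero_less_measure_iff)
    then have "b \<in> E i k"
      using b ev B by (simp add: E_def partition_classes_def malg_dist_class prob_sym_diff)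
    then have "b \<in> N (prod_encode (i, k))" using ik by (simp add: N_def)
    then show "b \<in> (\<Union>m. N m)" by blast
  qed
  moreover have "G \<subseteq> R" by (auto simp: G_def)
  ultimately have "comeager_in ?T G"
    unfolding comeager_in_def top by blast
  then show ?thesis unfolding ample_def G_def R_def .
qed

end

theorem lemma11:
  fixes M :: "'a measure" and n :: nat and A :: "nat \<Rightarrow> 'a set"
  assumes "standard_probability_space M"
    and "\<And>i. i < n \<Longrightarrow> A i \<in> sets M"
    and "\<And>i. i < n \<Longrightarrow> 0 < measure M (A i)"
    and "disjoint_family_on A {..<n}"
    and "(\<Union>i<n. A i) = space M"
  shows "ample M n (\<lambda>i\<in>{..<n}. malg_class M (A i))"
proof -
  interpret prob_space M using assms(1) by (simp add: standard_probability_space_def)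
  have "event_partition (space M) n A"
    using assms by (simp add: event_partition_def)
  then show ?thesis
    using partition_is_ample[OF assms(1)] assms(3) by (simp add: partition_classes_def)
qed

end
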